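(* There is an absolute constant $c>0$ such that for every centered convex body $K$ in $\mathbb{R}^n$, $$S(K)\leqslant c\,n^{3/2}\,|K|\,M(K).$$ In fact, $\sup\{p(K): K\text{ a centered convex body in }\mathbb{R}^n\}\approx n^{3/2}$.
   Context: A convex body in $\mathbb{R}^n$ is a compact convex set with non-empty interior; it is centered if its barycenter $\frac1{|K|}\int_Kx\,dx$ is the origin. $|\cdot|$ is volume, $S(K)$ is the surface area of $K$, $\sigma$ is the rotationally invariant probability measure on the unit sphere $S^{n-1}$. $\|x\|_K=\min\{t\geqslant0:x\in tK\}$ is the Minkowski functional of $K$, $M(K)=\int_{S^{n-1}}\|\xi\|_K\,d\sigma(\xi)$, and $p(K)=\frac{S(K)}{|K|M(K)}$. $a\approx b$ means that there are absolute constants $c_1,c_2>0$ (independent of $n$) with $c_1a\leqslant b\leqslant c_2a$. *)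

theory Defs
  imports "HOL-Analysis.Analysis"
begin

text \<open>
  The constants below must not depend on the dimension, so \<open>n\<close> has to be quantified inside the
  formula and cannot be a type. Hence \<open>\<real>\<^sup>n\<close> is \<^const>\<open>Euclidean_space\<close> \<open>n\<close>: the functions
  \<open>nat \<Rightarrow> real\<close> that vanish at all indices \<open>i \<ge> n\<close>, with coordinates \<open>x 0, \<dots>, x (n - 1)\<close>.
\<close>

definition norm_R :: "nat \<Rightarrow> (nat \<Rightarrow> real) \<Rightarrow> real" where
  "norm_R n x = sqrt (\<Sum>i<n. (x i)\<^sup>2)"

definition cball_R :: "nat \<Rightarrow> (nat \<Rightarrow> real) set" where
  "cball_R n = {x \<in> topspace (Euclidean_space n). norm_R n x \<le> 1}"

definition scale_set :: "real \<Rightarrow> (nat \<Rightarrow> real) set \<Rightarrow> (nat \<Rightarrow> real) set" where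
  "scale_set t A = (\<lambda>x i. t * x i) ` A"

definition minkowski_sum ::
    "(nat \<Rightarrow> real) set \<Rightarrow> (nat \<Rightarrow> real) set \<Rightarrow> (nat \<Rightarrow> real) set" where
  "minkowski_sum A B = {\<lambda>i. x i + y i | x y. x \<in> A \<and> y \<in> B}"

text \<open>
  The library's product measure lives on functions that are \<open>undefined\<close> outside \<open>{..<n}\<close>;
  it is transported to functions that are \<open>0\<close> there.
\<close>

definition embed_R :: "nat \<Rightarrow> (nat \<Rightarrow> real) \<Rightarrow> nat \<Rightarrow> real" where
  "embed_R n x = (\<lambda>i. if i < n then x i else 0)"

definition lborel_R :: "nat \<Rightarrow> (nat \<Rightarrow> real) measure" where
  "lborel_R n = distr (\<Pi>\<^sub>M i\<in>{..<n}. lborel) borel (embed_R n)"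

lemma measurable_embed_R: "embed_R n \<in> measurable (\<Pi>\<^sub>M i\<in>{..<n}. lborel) borel"
proof (rule measurable_coordinatewise_then_product)
  fix i
  show "(\<lambda>x. embed_R n x i) \<in> borel_measurable (\<Pi>\<^sub>M i\<in>{..<n}. lborel)"
    by (cases "i < n") (auto simp: embed_R_def)
qed

definition vol_R :: "nat \<Rightarrow> (nat \<Rightarrow> real) set \<Rightarrow> real" where
  "vol_R n A = measure (lborel_R n) A"

definition convex_R :: "(nat \<Rightarrow> real) set \<Rightarrow> bool" where
  "convex_R A \<longleftrightarrow>
    (\<forall>x\<in>A. \<forall>y\<in>A. \<forall>u\<ge>0. \<forall>v\<ge>0. u + v = 1 \<longrightarrow> (\<lambda>i. u * x i + v * y i) \<in> A)"

definition convex_body :: "nat \<Rightarrow> (nat \<Rightarrow> real) set \<Rightarrow> bool" where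
  "convex_body n K \<longleftrightarrow>
    compactin (Euclidean_space n) K \<and> convex_R K \<and> Euclidean_space n interior_of K \<noteq> {}"

definition barycenter :: "nat \<Rightarrow> (nat \<Rightarrow> real) set \<Rightarrow> nat \<Rightarrow> real" where
  "barycenter n K = (\<lambda>i. 1 / vol_R n K * (LINT x:K|lborel_R n. x i))"

definition centered :: "nat \<Rightarrow> (nat \<Rightarrow> real) set \<Rightarrow> bool" where
  "centered n K \<longleftrightarrow> barycenter n K = (\<lambda>i. 0)"

text \<open>
  Surface area as Minkowski content, i.e. the derivative of \<open>vol_R (K + t B)\<close> at \<open>t = 0+\<close>, where
  \<open>B\<close> is the Euclidean unit ball. For a convex body the limit exists and is finite
  (Steiner's formula), so the lower limit is the limit; \<^typ>\<open>ereal\<close> keeps it meaningful for all sets.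
\<close>

definition surface_area :: "nat \<Rightarrow> (nat \<Rightarrow> real) set \<Rightarrow> ereal" where
  "surface_area n K = Liminf (at_right 0)
    (\<lambda>t. ereal ((vol_R n (minkowski_sum K (scale_set t (cball_R n))) - vol_R n K) / t))"

text \<open>
  The rotationally invariant probability measure on the unit sphere: the law of \<open>x / \<bar>x\<bar>\<close> for \<open>x\<close>
  uniform in the unit ball (normalized cone measure of the ball), regarded as a measure on the
  ambient space. The point \<open>x = 0\<close> is a null set when \<open>n \<ge> 1\<close>.
\<close>

definition normalize_R :: "nat \<Rightarrow> (nat \<Rightarrow> real) \<Rightarrow> nat \<Rightarrow> real" where
  "normalize_R n x = (\<lambda>i. x i / norm_R n x)"

definition sphere_measure :: "nat \<Rightarrow> (nat \<Rightarrow> real) measure" where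
  "sphere_measure n = distr (uniform_measure (lborel_R n) (cball_R n)) borel (normalize_R n)"

lemma measurable_normalize_R: "normalize_R n \<in> borel_measurable borel"
proof (rule measurable_coordinatewise_then_product)
  fix i
  have c: "(\<lambda>x. x j) \<in> borel_measurable borel" for j :: nat and x :: "nat \<Rightarrow> real"
    by (rule measurable_product_coordinates)
  show "(\<lambda>x. normalize_R n x i) \<in> borel_measurable borel"
    unfolding normalize_R_def norm_R_def by measurable
qed

text \<open>
  For a convex body with \<open>0\<close> in its interior (in particular, a centered one) the infimum is attained,
  so it is the minimum.
\<close>

definition minkowski_functional :: "(nat \<Rightarrow> real) set \<Rightarrow> (nat \<Rightarrow> real) \<Rightarrow> real" where
  "minkowski_functional K x = Inf {t. 0 \<le> t \<and> x \<in> scale_set t K}"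

definition M_mean :: "nat \<Rightarrow> (nat \<Rightarrow> real) set \<Rightarrow> real" where
  "M_mean n K = (LINT \<xi>|sphere_measure n. minkowski_functional K \<xi>)"

definition p_ratio :: "nat \<Rightarrow> (nat \<Rightarrow> real) set \<Rightarrow> ereal" where
  "p_ratio n K = surface_area n K / ereal (vol_R n K * M_mean n K)"

end

theory Submission
  imports Defs
begin

text \<open>
  The upper bound compares \<open>K\<close> with the largest ball \<open>r B\<close> around the origin that it contains.
  On the one hand, \<open>r B \<subseteq> K\<close> gives \<open>K + t B \<subseteq> (1 + t/r) K\<close> and hence \<open>S(K) \<le> n \<bar>K\<bar>/r\<close>
  (\<open>surface_area_le\<close>). On the other hand, \<open>K\<close> touches the ball and therefore lies in a half-space
  \<open>\<langle>y, u\<rangle> \<le> r\<close> with a unit vector \<open>u\<close> (\<open>separating_direction\<close>). There \<open>\<parallel>\<xi>\<parallel>\<^sub>K \<ge> \<langle>\<xi>, u\<rangle>/r\<close>, and the mean of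
  the positive part of \<open>\<langle>\<xi>, u\<rangle>\<close> over the sphere has order \<open>1/\<surd>n\<close>, so that \<open>1/r\<close> is at most of order
  \<open>\<surd>n M(K)\<close> (\<open>M_mean_lower_bound\<close>). Together this is the bound of order \<open>n\<^sup>3\<^sup>/\<^sup>2\<close>. The comparison makes
  sense because a convex body contains a ball around its barycenter (\<open>centered_contains_ball\<close>).
  
  The mean of the positive part is estimated on the ball instead of the sphere, which can only
  decrease it. There the second and fourth moments of \<open>\<langle>x, u\<rangle>\<close> are computed exactly by integration by
  parts (\<open>ball_integral_by_parts\<close>), and a mean-zero function whose fourth moment is bounded by a multiple of
  the square of its second moment has a positive part of the expected size.
  
  Equality in both comparisons, up to constants, requires a body whose facets are all about equally far
  from the origin, like a circumscribed polytope, while its Minkowski functional is dominated by a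
  single direction, like that of a slab. A flat double cone over a large cube in the hyperplane
  \<open>x\<^sub>0 = 0\<close> has both properties: its volume is \<open>2/n\<close> times that of its base while its surface area is at
  least twice that of the base (\<open>surface_area_double_cone\<close>), and \<open>\<parallel>\<xi>\<parallel>\<^sub>K\<close> is at most \<open>\<bar>\<xi>\<^sub>0\<bar>\<close> plus the
  average of the \<open>\<bar>\<xi>\<^sub>i\<bar>\<close>, which has a mean of order \<open>1/\<surd>n\<close> (\<open>M_mean_double_cone\<close>).
\<close>

section \<open>Norm, volume and scaling in coordinate space\<close>

lemma space_lborel_R [simp]: "space (lborel_R n) = UNIV"
  and sets_lborel_R [simp, measurable_cong]: "sets (lborel_R n) = sets borel"
  by (simp_all add: lborel_R_def)

lemma measurable_coordinate_R [measurable]: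
  "(\<lambda>x::nat \<Rightarrow> real. x i) \<in> borel_measurable borel"
  by (rule measurable_product_coordinates)

lemma norm_R_eq_L2_set: "norm_R n x = L2_set x {..<n}"
  by (simp add: norm_R_def L2_set_def)

lemma norm_R_sq: "(norm_R n x)\<^sup>2 = (\<Sum>i<n. (x i)\<^sup>2)"
  by (simp add: norm_R_def sum_nonneg)

lemma norm_R_nonneg [simp]: "0 \<le> norm_R n x"
  by (simp add: norm_R_eq_L2_set)

lemma norm_R_scale: "norm_R n (\<lambda>i. c * x i) = \<bar>c\<bar> * norm_R n x"
  by (simp add: norm_R_def power_mult_distrib sum_distrib_left[symmetric] real_sqrt_mult)

lemma abs_coordinate_le_norm_R: "i < n \<Longrightarrow> \<bar>x i\<bar> \<le> norm_R n x"
  unfolding norm_R_def by (rule real_le_rsqrt) (auto intro!: member_le_sum)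

lemma continuous_on_norm_R [continuous_intros]: "continuous_on S (norm_R n)"
  unfolding norm_R_def
  by (intro continuous_intros continuous_on_subset[OF continuous_on_product_coordinates]) auto

lemma continuous_on_coordinate_R [continuous_intros]:
  "continuous_on S (\<lambda>x::nat \<Rightarrow> real. x i)"
  by (rule continuous_on_subset[OF continuous_on_product_coordinates]) auto

lemma emeasure_lborel_R:
  assumes "A \<in> sets borel"
  shows "emeasure (lborel_R n) A =
    emeasure (\<Pi>\<^sub>M i\<in>{..<n}. lborel) (embed_R n -` A \<inter> space (\<Pi>\<^sub>M i\<in>{..<n}. lborel))"
  unfolding lborel_R_def using assms by (rule emeasure_distr[OF measurable_embed_R])

lemma integral_lborel_R:
  fixes f :: "(nat \<Rightarrow> real) \<Rightarrow> real"
  assumes "f \<in> borel_measurable borel"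
  shows "(LINT x|lborel_R n. f x) = (LINT x|(\<Pi>\<^sub>M i\<in>{..<n}. lborel). f (embed_R n x))"
  unfolding lborel_R_def by (rule integral_distr[OF measurable_embed_R assms])

text \<open>
  Cubes are the sets whose volume is known from the product measure. Every volume estimate that
  only needs positivity or finiteness compares with one of them.
\<close>

definition box_R :: "nat \<Rightarrow> (nat \<Rightarrow> real) \<Rightarrow> real \<Rightarrow> (nat \<Rightarrow> real) set" where
  "box_R n z \<rho> = {x \<in> topspace (Euclidean_space n). \<forall>i<n. \<bar>x i - z i\<bar> \<le> \<rho>}"

lemma compact_box_R: "compact (box_R n z \<rho>)"
proof -
  define I where "I i = (if i < n then {z i - \<rho>..z i + \<rho>} else {0})" for i
  have "x \<in> box_R n z \<rho> \<longleftrightarrow> (\<forall>i. x i \<in> I i)" for x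
    unfolding box_R_def I_def topspace_Euclidean_space mem_Collect_eq
    by (smt (verit) atLeastAtMost_iff linorder_not_less singleton_iff)
  then have "box_R n z \<rho> = Pi\<^sub>E UNIV I"
    by (auto simp: PiE_def Pi_def)
  moreover have "compactin (product_topology (\<lambda>i. euclidean) UNIV) (Pi\<^sub>E UNIV I)"
    by (subst compactin_PiE) (auto simp: I_def)
  ultimately show ?thesis
    by (metis compactin_euclidean_iff euclidean_product_topology)
qed

lemma box_R_borel [measurable]: "box_R n z \<rho> \<in> sets borel"
  by (simp add: borel_closed compact_box_R compact_imp_closed)

lemma emeasure_box_R:
  assumes "0 \<le> \<rho>"
  shows "emeasure (lborel_R n) (box_R n z \<rho>) = ennreal ((2 * \<rho>) ^ n)"
proof -
  interpret product_sigma_finite "\<lambda>_::nat. lborel :: real measure" ..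
  have iv: "\<bar>a - b\<bar> \<le> \<rho> \<longleftrightarrow> a \<in> {b - \<rho>..b + \<rho>}" for a b :: real
    by auto
  have "embed_R n -` box_R n z \<rho> \<inter> space (\<Pi>\<^sub>M i\<in>{..<n}. lborel) =
      Pi\<^sub>E {..<n} (\<lambda>i. {z i - \<rho>..z i + \<rho>})"
    unfolding box_R_def embed_R_def topspace_Euclidean_space iv
    by (auto simp: space_PiM PiE_def Pi_def)
  then have "emeasure (lborel_R n) (box_R n z \<rho>) = (\<Prod>i<n. emeasure lborel {z i - \<rho>..z i + \<rho>})"
    by (subst emeasure_lborel_R) (auto simp: emeasure_PiM)
  also have "\<dots> = ennreal ((2 * \<rho>) ^ n)"
    using assms by (simp add: prod_ennreal ennreal_power)
  finally show ?thesis .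
qed

lemma convex_body_compact: "convex_body n K \<Longrightarrow> compact K"
  and convex_body_subset: "convex_body n K \<Longrightarrow> K \<subseteq> topspace (Euclidean_space n)"
  unfolding convex_body_def Euclidean_space_def
  by (auto simp: compactin_subtopology euclidean_product_topology)

lemma compact_subset_box_R:
  assumes "compact K" "K \<subseteq> topspace (Euclidean_space n)"
  obtains R where "0 < R" "K \<subseteq> box_R n (\<lambda>i. 0) R"
proof -
  have "compact (norm_R n ` K)"
    by (intro compact_continuous_image assms continuous_intros)
  then obtain R where R: "\<And>x. x \<in> K \<Longrightarrow> norm_R n x \<le> R"
    by (metis bounded_imp_bdd_above bdd_above.E compact_imp_bounded imageI)
  have "K \<subseteq> box_R n (\<lambda>i. 0) (max R 1)"
  proof
    fix x assume "x \<in> K"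
    then have "\<bar>x i\<bar> \<le> max R 1" if "i < n" for i
      using abs_coordinate_le_norm_R[OF that, of x] R[of x] by linarith
    then show "x \<in> box_R n (\<lambda>i. 0) (max R 1)"
      using \<open>x \<in> K\<close> assms(2) by (auto simp: box_R_def)
  qed
  then show ?thesis by (intro that[of "max R 1"]) auto
qed

lemma emeasure_compact_R:
  assumes "compact K" "K \<subseteq> topspace (Euclidean_space n)"
  shows "emeasure (lborel_R n) K < \<infinity>"
proof -
  obtain R where "0 < R" "K \<subseteq> box_R n (\<lambda>i. 0) R"
    using compact_subset_box_R[OF assms] .
  then have "emeasure (lborel_R n) K \<le> ennreal ((2 * R) ^ n)"
    by (metis emeasure_box_R emeasure_mono box_R_borel sets_lborel_R less_imp_le)
  then show ?thesis by (simp add: order_le_less_trans)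
qed

lemma fmeasurable_compact_R:
  assumes "compact K" "K \<subseteq> topspace (Euclidean_space n)"
  shows "K \<in> fmeasurable (lborel_R n)"
  using emeasure_compact_R[OF assms] assms
  by (intro fmeasurableI) (auto intro: borel_compact)

lemma vol_R_pos_of_box:
  assumes "compact K" "K \<subseteq> topspace (Euclidean_space n)" "0 < \<rho>" "box_R n z \<rho> \<subseteq> K"
  shows "0 < vol_R n K"
proof -
  have "0 < (2 * \<rho>) ^ n" using assms by simp
  also have "\<dots> = measure (lborel_R n) (box_R n z \<rho>)"
    using assms(3) by (simp add: measure_def emeasure_box_R)
  also have "\<dots> \<le> measure (lborel_R n) K"
    by (intro measure_mono_fmeasurable assms fmeasurable_compact_R) auto
  finally show ?thesis by (simp add: vol_R_def)
qed

lemma cball_R_eq: "cball_R n = {x. (\<forall>i\<ge>n. x i = 0) \<and> norm_R n x \<le> 1}"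
  by (auto simp: cball_R_def topspace_Euclidean_space)

lemma compact_Euclidean_closed_subset:
  assumes "closed A" "A \<subseteq> box_R n z \<rho>"
  shows "compact A"
  using compact_Int_closed[OF compact_box_R assms(1)] assms(2)
  by (metis inf.absorb_iff2)

lemma closed_Euclidean_R: "closed (topspace (Euclidean_space n))"
  using closedin_Euclidean_imp_closed closedin_topspace by blast

lemma compact_norm_cball_R:
  "compact {x \<in> topspace (Euclidean_space n). norm_R n (\<lambda>i. x i - z i) \<le> \<rho>}"
proof (rule compact_Euclidean_closed_subset)
  have "closed {x. norm_R n (\<lambda>i. x i - z i) \<le> \<rho>}"
    unfolding norm_R_def by (intro closed_Collect_le continuous_intros)
  then show "closed {x \<in> topspace (Euclidean_space n). norm_R n (\<lambda>i. x i - z i) \<le> \<rho>}"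
    using closed_Int[OF closed_Euclidean_R[of n]] by (simp add: Collect_conj_eq)
  show "{x \<in> topspace (Euclidean_space n). norm_R n (\<lambda>i. x i - z i) \<le> \<rho>} \<subseteq> box_R n z \<rho>"
    using abs_coordinate_le_norm_R[of _ n "\<lambda>i. _ i - z i"]
    by (fastforce simp: box_R_def intro: order.trans)
qed

lemma compact_cball_R: "compact (cball_R n)"
  using compact_norm_cball_R[of n "\<lambda>i. 0" 1] by (simp add: cball_R_def)

lemma cball_R_subset: "cball_R n \<subseteq> topspace (Euclidean_space n)"
  by (auto simp: cball_R_def)

lemma cball_R_borel [measurable]: "cball_R n \<in> sets borel"
  by (simp add: borel_compact compact_cball_R)

lemma box_R_subset_norm_ball:
  assumes "1 \<le> n" "0 \<le> \<rho>"
  shows "box_R n z (\<rho> / n) \<subseteq> {x \<in> topspace (Euclidean_space n). norm_R n (\<lambda>i. x i - z i) \<le> \<rho>}"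
proof clarsimp
  fix x assume x: "x \<in> box_R n z (\<rho> / n)"
  have "norm_R n (\<lambda>i. x i - z i) \<le> (\<Sum>i<n. \<bar>x i - z i\<bar>)"
    unfolding norm_R_eq_L2_set by (rule L2_set_le_sum_abs)
  also have "\<dots> \<le> (\<Sum>i<n. \<rho> / n)"
    using x by (intro sum_mono) (auto simp: box_R_def)
  also have "\<dots> = \<rho>" using assms by simp
  finally show "x \<in> topspace (Euclidean_space n) \<and> norm_R n (\<lambda>i. x i - z i) \<le> \<rho>"
    using x by (auto simp: box_R_def)
qed

lemma vol_norm_ball_pos:
  assumes "1 \<le> n" "0 < \<rho>"
  shows "0 < vol_R n {x \<in> topspace (Euclidean_space n). norm_R n (\<lambda>i. x i - z i) \<le> \<rho>}"
  using assms
  by (intro vol_R_pos_of_box[OF compact_norm_cball_R _ _ box_R_subset_norm_ball[of n \<rho> z]]) auto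

lemma vol_cball_pos: "1 \<le> n \<Longrightarrow> 0 < vol_R n (cball_R n)"
  using vol_norm_ball_pos[of n 1 "\<lambda>i. 0"] by (simp add: cball_R_def)

lemma measurable_scale [measurable]:
  "(\<lambda>x i. c * x i :: real) \<in> borel \<rightarrow>\<^sub>M (borel :: (nat \<Rightarrow> real) measure)"
  by (rule measurable_coordinatewise_then_product) simp

text \<open>
  On a product of intervals the claim is the one-dimensional scaling rule in each coordinate, and
  products of measurable sets determine a product measure. The case \<open>c = -1\<close> is central symmetry.
\<close>

lemma lborel_R_scale:
  assumes "c \<noteq> 0"
  shows "distr (lborel_R n) borel (\<lambda>x i. c * x i) = density (lborel_R n) (\<lambda>_. ennreal (inverse \<bar>c\<bar> ^ n))"
proof -
  interpret product_sigma_finite "\<lambda>_::nat. lborel :: real measure" ..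
  let ?P = "\<Pi>\<^sub>M i\<in>{..<n}. (lborel :: real measure)"
  let ?T = "\<lambda>x. \<lambda>i\<in>{..<n}. c * x i"
  let ?k = "ennreal (\<bar>c\<bar> ^ n)" and ?k' = "ennreal (inverse \<bar>c\<bar> ^ n)"
  have kk: "?k' * ?k = 1"
    using assms by (simp add: ennreal_mult[symmetric] power_mult_distrib[symmetric])
  have T[measurable]: "?T \<in> ?P \<rightarrow>\<^sub>M ?P"
  proof (rule measurable_restrict)
    fix i assume "i \<in> {..<n}"
    then have "(\<lambda>x. x i) \<in> borel_measurable ?P"
      using measurable_component_singleton[of i "{..<n}" "\<lambda>_. lborel :: real measure"] by simp
    then show "(\<lambda>x. c * x i) \<in> ?P \<rightarrow>\<^sub>M lborel"
      by simp
  qed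
  have "density (distr ?P ?P ?T) (\<lambda>_. ?k) = ?P"
  proof (rule PiM_eqI)
    fix A :: "nat \<Rightarrow> real set" assume A: "\<And>i. i \<in> {..<n} \<Longrightarrow> A i \<in> sets lborel"
    have "?T -` (Pi\<^sub>E {..<n} A) \<inter> space ?P = Pi\<^sub>E {..<n} (\<lambda>i. (\<lambda>s. c * s) -` A i)"
      by (auto simp: space_PiM PiE_def Pi_def extensional_def restrict_def)
    then have "emeasure (distr ?P ?P ?T) (Pi\<^sub>E {..<n} A) =
        (\<Prod>i<n. emeasure lborel ((\<lambda>s. c * s) -` A i))"
      using A by (subst emeasure_distr[OF T]) (auto intro!: sets_PiM_I_finite emeasure_PiM
         measurable_sets_borel[of _ borel])
    also have "\<dots> = (\<Prod>i<n. ennreal (inverse \<bar>c\<bar>) * emeasure lborel (A i))"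
    proof (rule prod.cong)
      fix i assume "i \<in> {..<n}"
      then have "A i \<in> sets borel" using A by simp
      have "emeasure lborel ((\<lambda>s. c * s) -` A i) = emeasure (distr lborel borel ((*) c)) (A i)"
        using \<open>A i \<in> sets borel\<close> by (subst emeasure_distr) auto
      also have "\<dots> = ennreal (inverse \<bar>c\<bar>) * emeasure lborel (A i)"
        using \<open>A i \<in> sets borel\<close> assms by (simp add: lborel_distr_mult emeasure_density_const)
      finally show "emeasure lborel ((\<lambda>s. c * s) -` A i) = ennreal (inverse \<bar>c\<bar>) * emeasure lborel (A i)" .
    qed simp
    also have "\<dots> = ?k' * (\<Prod>i<n. emeasure lborel (A i))"
      by (simp add: prod.distrib ennreal_power)
    finally have "emeasure (density (distr ?P ?P ?T) (\<lambda>_. ?k)) (Pi\<^sub>E {..<n} A) =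
        (?k' * ?k) * (\<Prod>i<n. emeasure lborel (A i))"
      using A by (subst emeasure_density_const) (auto intro!: sets_PiM_I_finite simp: mult_ac)
    then show "emeasure (density (distr ?P ?P ?T) (\<lambda>_. ?k)) (Pi\<^sub>E {..<n} A) =
        (\<Prod>i\<in>{..<n}. emeasure lborel (A i))"
      by (simp add: kk)
  qed auto
  then have "density (density (distr ?P ?P ?T) (\<lambda>_. ?k)) (\<lambda>_. ?k') = density ?P (\<lambda>_. ?k')"
    by simp
  then have 1: "distr ?P ?P ?T = density ?P (\<lambda>_. ?k')"
    using kk by (simp add: density_density_eq mult.commute density_1)
  have "distr (lborel_R n) borel (\<lambda>x i. c * x i) = distr ?P borel ((\<lambda>x i. c * x i) \<circ> embed_R n)"
    unfolding lborel_R_def by (intro distr_distr measurable_embed_R) simp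
  also have "(\<lambda>x i. c * x i) \<circ> embed_R n = embed_R n \<circ> ?T"
    by (auto simp: fun_eq_iff embed_R_def)
  also have "distr ?P borel (embed_R n \<circ> ?T) = distr (distr ?P ?P ?T) borel (embed_R n)"
    by (intro distr_distr[symmetric] measurable_embed_R T)
  also have "\<dots> = density (lborel_R n) (\<lambda>_. ?k')"
    unfolding 1 lborel_R_def by (subst density_distr) (auto intro: measurable_embed_R)
  finally show ?thesis .
qed

lemma scale_set_eq_vimage:
  "c \<noteq> 0 \<Longrightarrow> scale_set c A = (\<lambda>x i. inverse c * x i) -` A"
  by (auto simp: scale_set_def image_iff fun_eq_iff field_simps intro!: bexI[of _ "\<lambda>i. _ i / c"])

lemma vol_scale_set:
  assumes "0 < c" "A \<in> sets borel"
  shows "vol_R n (scale_set c A) = c ^ n * vol_R n A"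
proof -
  have "vol_R n (scale_set c A) = measure (distr (lborel_R n) borel (\<lambda>x i. inverse c * x i)) A"
    unfolding vol_R_def using assms by (subst measure_distr) (auto simp: scale_set_eq_vimage)
  also have "\<dots> = c ^ n * vol_R n A"
    using assms by (subst lborel_R_scale) (auto simp: measure_density_const vol_R_def)
  finally show ?thesis .
qed

lemma integral_lborel_R_uminus:
  fixes f :: "(nat \<Rightarrow> real) \<Rightarrow> real"
  assumes [measurable]: "f \<in> borel_measurable borel"
  shows "(LINT x|lborel_R n. f (\<lambda>i. - x i)) = (LINT x|lborel_R n. f x)"
proof -
  have "distr (lborel_R n) borel (\<lambda>x i. -1 * x i) = lborel_R n"
    by (subst lborel_R_scale) (auto simp: density_1)
  then have "(LINT x|lborel_R n. f x) = (LINT x|distr (lborel_R n) borel (\<lambda>x i. -1 * x i). f x)"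
    by simp
  also have "\<dots> = (LINT x|lborel_R n. f (\<lambda>i. -1 * x i))"
    by (rule integral_distr) measurable
  finally show ?thesis by simp
qed

lemma compact_scale_set: "compact A \<Longrightarrow> compact (scale_set c A)"
  unfolding scale_set_def by (intro compact_continuous_image continuous_intros)

lemma scale_set_subset:
  "A \<subseteq> topspace (Euclidean_space n) \<Longrightarrow> scale_set c A \<subseteq> topspace (Euclidean_space n)"
  by (auto simp: scale_set_def topspace_Euclidean_space subset_iff)

lemma compact_minkowski_sum:
  assumes "compact A" "compact B"
  shows "compact (minkowski_sum A B)"
proof -
  have "minkowski_sum A B = (\<lambda>p i. fst p i + snd p i) ` (A \<times> B)"
  proof (intro set_eqI iffI)
    fix p assume "p \<in> minkowski_sum A B"
    then obtain x y where "p = (\<lambda>i. x i + y i)" "x \<in> A" "y \<in> B"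
      unfolding minkowski_sum_def by blast
    then show "p \<in> (\<lambda>p i. fst p i + snd p i) ` (A \<times> B)"
      by (intro image_eqI[of _ _ "(x, y)"]) auto
  next
    fix p assume "p \<in> (\<lambda>p i. fst p i + snd p i) ` (A \<times> B)"
    then show "p \<in> minkowski_sum A B"
      unfolding minkowski_sum_def by (elim imageE SigmaE) auto
  qed
  moreover have "continuous_on (A \<times> B) (\<lambda>p i. fst p i + snd p i)"
  proof (rule continuous_on_coordinatewise_then_product)
    fix i
    have "continuous_on (A \<times> B) (\<lambda>p. fst p i)"
      by (rule continuous_on_compose2[OF continuous_on_coordinate_R[of UNIV] continuous_on_fst[OF continuous_on_id]]) simp
    moreover have "continuous_on (A \<times> B) (\<lambda>p. snd p i)"
      by (rule continuous_on_compose2[OF continuous_on_coordinate_R[of UNIV] continuous_on_snd[OF continuous_on_id]]) simp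
    ultimately show "continuous_on (A \<times> B) (\<lambda>p. fst p i + snd p i)"
      by (rule continuous_on_add)
  qed
  ultimately show ?thesis
    using compact_continuous_image[OF _ compact_Times[OF assms]] by simp
qed

section \<open>Moments of a linear functional on the unit ball\<close>

lemma integrable_bounded_on_compact_R:
  fixes f :: "(nat \<Rightarrow> real) \<Rightarrow> real"
  assumes "compact A" "A \<subseteq> topspace (Euclidean_space n)"
    and "f \<in> borel_measurable borel" "\<And>x. x \<in> A \<Longrightarrow> \<bar>f x\<bar> \<le> B"
  shows "integrable (lborel_R n) (\<lambda>x. indicator A x * f x)"
  using integrableI_bounded_set_indicator[of A "lborel_R n" f B]
    emeasure_compact_R[OF assms(1,2)] assms
  by (simp add: borel_compact measurable_lborel1)

lemma integrable_continuous_on_compact_R: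
  fixes f :: "(nat \<Rightarrow> real) \<Rightarrow> real"
  assumes "compact A" "A \<subseteq> topspace (Euclidean_space n)" "continuous_on UNIV f"
  shows "integrable (lborel_R n) (\<lambda>x. indicator A x * f x)"
proof -
  have "compact (f ` A)"
    using assms by (intro compact_continuous_image) (auto intro: continuous_on_subset)
  then obtain B where "\<And>x. x \<in> A \<Longrightarrow> norm (f x) \<le> B"
    by (metis bounded_iff compact_imp_bounded imageI)
  then show ?thesis
    using assms
    by (intro integrable_bounded_on_compact_R[where B = B] borel_measurable_continuous_onI) auto
qed

text \<open>
  Integration over the unit ball without normalization, so that no division by the volume of the
  ball appears in the identities below.
\<close>

definition ball_integral :: "nat \<Rightarrow> ((nat \<Rightarrow> real) \<Rightarrow> real) \<Rightarrow> real" where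
  "ball_integral n f = (LINT x|lborel_R n. indicator (cball_R n) x * f x)"

lemmas integrable_on_cball_R =
  integrable_continuous_on_compact_R[OF compact_cball_R cball_R_subset]

lemma ball_integral_add:
  "continuous_on UNIV f \<Longrightarrow> continuous_on UNIV g \<Longrightarrow>
    ball_integral n (\<lambda>x. f x + g x) = ball_integral n f + ball_integral n g"
  unfolding ball_integral_def by (simp add: distrib_left integrable_on_cball_R)

lemma ball_integral_diff:
  "continuous_on UNIV f \<Longrightarrow> continuous_on UNIV g \<Longrightarrow>
    ball_integral n (\<lambda>x. f x - g x) = ball_integral n f - ball_integral n g"
  unfolding ball_integral_def by (simp add: right_diff_distrib integrable_on_cball_R)

lemma ball_integral_cmult: "ball_integral n (\<lambda>x. c * f x) = c * ball_integral n f"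
  unfolding ball_integral_def by (simp add: mult.left_commute)

lemma ball_integral_sum:
  "(\<And>i. i \<in> I \<Longrightarrow> continuous_on UNIV (f i)) \<Longrightarrow>
    ball_integral n (\<lambda>x. \<Sum>i\<in>I. f i x) = (\<Sum>i\<in>I. ball_integral n (f i))"
  unfolding ball_integral_def by (simp add: sum_distrib_left integrable_on_cball_R)

lemma ball_integral_1: "ball_integral n (\<lambda>x. 1) = vol_R n (cball_R n)"
  by (simp add: ball_integral_def vol_R_def)

lemma continuous_on_fun_upd_R: "continuous_on S (\<lambda>s. (x::nat \<Rightarrow> real)(i := s))"
proof (rule continuous_on_coordinatewise_then_product)
  show "continuous_on S (\<lambda>s. (x(i := s)) j)" for j
    by (cases "j = i") (auto intro: continuous_intros)
qed

lemma norm_R_fun_upd: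
  assumes "i < n"
  shows "(norm_R n (x(i := s)))\<^sup>2 = s\<^sup>2 + (\<Sum>j\<in>{..<n}-{i}. (x j)\<^sup>2)"
  using assms by (simp add: norm_R_sq sum.remove[of _ i])

text \<open>
  The divergence theorem on the ball for a field in a coordinate direction: on every line in that
  direction the ball cuts out a segment with both end points on the sphere, where \<open>g\<close> vanishes, so
  the fundamental theorem of calculus gives \<open>0\<close> on each line.
\<close>

lemma ball_integral_partial_derivative:
  fixes g g' :: "(nat \<Rightarrow> real) \<Rightarrow> real"
  assumes "i < n"
    and deriv: "\<And>x s. ((\<lambda>s. g (x(i := s))) has_real_derivative g' (x(i := s))) (at s)"
    and cont: "continuous_on UNIV g'"
    and boundary: "\<And>x. norm_R n x = 1 \<Longrightarrow> g x = 0"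
  shows "ball_integral n g' = 0"
proof -
  interpret product_sigma_finite "\<lambda>_::nat. lborel :: real measure" ..
  let ?I = "{..<n} - {i}"
  define f where "f x = indicator (cball_R n) x * g' x" for x
  have ins: "insert i ?I = {..<n}" using assms(1) by auto
  have [measurable]: "g' \<in> borel_measurable borel"
    by (rule borel_measurable_continuous_onI[OF cont])
  have f[measurable]: "f \<in> borel_measurable borel"
    unfolding f_def by measurable
  have "integrable (lborel_R n) f"
    unfolding f_def by (rule integrable_on_cball_R[OF cont])
  then have int: "integrable (\<Pi>\<^sub>M i\<in>{..<n}. lborel) (\<lambda>x. f (embed_R n x))"
    unfolding lborel_R_def using integrable_distr_eq[OF measurable_embed_R f] by simp
  have inner: "(LINT s|lborel. f (embed_R n (y(i := s)))) = 0" for y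
  proof -
    define w where "w = embed_R n y"
    have w: "embed_R n (y(i := s)) = w(i := s)" for s
      using assms(1) by (auto simp: w_def embed_R_def)
    define q where "q = (\<Sum>j\<in>?I. (w j)\<^sup>2)"
    have mem: "w(i := s) \<in> cball_R n \<longleftrightarrow> s\<^sup>2 \<le> 1 - q" for s
    proof -
      have "norm_R n (w(i := s)) \<le> 1 \<longleftrightarrow> (norm_R n (w(i := s)))\<^sup>2 \<le> 1\<^sup>2"
        by (rule power2_le_iff_abs_le[symmetric, THEN trans[rotated]]) auto
      then show ?thesis
        using assms(1) unfolding norm_R_fun_upd[OF assms(1)]
        by (auto simp: cball_R_eq q_def w_def embed_R_def)
    qed
    show ?thesis
    proof (cases "q \<le> 1")
      case False
      have "\<not> s\<^sup>2 \<le> 1 - q" for s using False zero_le_power2[of s] by linarith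
      then have "f (w(i := s)) = 0" for s
        by (simp add: f_def mem)
      then show ?thesis by (simp add: w)
    next
      case True
      define a where "a = sqrt (1 - q)"
      have a: "0 \<le> a" "a\<^sup>2 = 1 - q" using True by (auto simp: a_def)
      have "s\<^sup>2 \<le> 1 - q \<longleftrightarrow> s \<in> {-a..a}" for s
        unfolding a(2)[symmetric] using a(1) by (auto simp: power2_le_iff_abs_le abs_le_iff)
      then have "f (w(i := s)) = g' (w(i := s)) * indicator {-a..a} s" for s
        by (auto simp: f_def mem indicator_def)
      moreover have "(LINT s|lborel. g' (w(i := s)) * indicator {-a..a} s) =
          g (w(i := a)) - g (w(i := - a))"
      proof (rule integral_FTC_Icc_real)
        show "isCont (\<lambda>s. g' (w(i := s))) s" for s
        proof -
          have "continuous_on UNIV (\<lambda>s. g' (w(i := s)))"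
            by (rule continuous_on_compose2[OF cont continuous_on_fun_upd_R]) simp
          then show ?thesis by (simp add: continuous_on_eq_continuous_at)
        qed
        show "((\<lambda>s. g (w(i := s))) has_real_derivative g' (w(i := s))) (at s)" for s
          by (rule deriv)
      qed (use a in auto)
      moreover have "norm_R n (w(i := b)) = 1" if "b\<^sup>2 = 1 - q" for b
      proof -
        have "(norm_R n (w(i := b)))\<^sup>2 = 1\<^sup>2"
          using that by (simp add: norm_R_fun_upd[OF assms(1)] q_def)
        then show ?thesis by (subst (asm) power2_eq_iff_nonneg) auto
      qed
      ultimately show ?thesis
        using a(2) by (simp add: w boundary)
    qed
  qed
  have "ball_integral n g' = (LINT x|(\<Pi>\<^sub>M i\<in>{..<n}. lborel). f (embed_R n x))"
    unfolding ball_integral_def f_def[symmetric] by (rule integral_lborel_R[OF f])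
  also have "\<dots> = (LINT y|(\<Pi>\<^sub>M i\<in>?I. lborel). LINT s|lborel. f (embed_R n (y(i := s))))"
    using product_integral_insert[of ?I i "\<lambda>x. f (embed_R n x)"] int
    unfolding ins by simp
  also have "\<dots> = 0" by (simp add: inner)
  finally show ?thesis .
qed

definition inner_R :: "nat \<Rightarrow> (nat \<Rightarrow> real) \<Rightarrow> (nat \<Rightarrow> real) \<Rightarrow> real" where
  "inner_R n x u = (\<Sum>i<n. x i * u i)"

lemma continuous_on_inner_R [continuous_intros]: "continuous_on S (\<lambda>x. inner_R n x u)"
  unfolding inner_R_def by (intro continuous_intros)

lemma inner_R_scale: "inner_R n (\<lambda>i. c * x i) u = c * inner_R n x u"
  by (simp add: inner_R_def sum_distrib_left mult.assoc)

lemma inner_R_fun_upd: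
  "i < n \<Longrightarrow> inner_R n (x(i := s)) u = s * u i + (\<Sum>j\<in>{..<n}-{i}. x j * u j)"
  by (simp add: inner_R_def sum.remove[of _ i])

lemma inner_R_basis: "i < n \<Longrightarrow> inner_R n x (\<lambda>j. if j = i then 1 else 0) = x i"
  by (simp add: inner_R_def if_distrib cong: if_cong)

lemma norm_R_basis: "i < n \<Longrightarrow> norm_R n (\<lambda>j. if j = i then 1 else 0) = 1"
  by (simp add: norm_R_def if_distrib[of "\<lambda>x. x\<^sup>2"] cong: if_cong)

text \<open>
  With \<open>X = \<langle>x, u\<rangle>\<close> and \<open>Q = 1 - \<bar>x\<bar>\<^sup>2\<close>, the function \<open>\<phi>(X) Q\<^sup>k\<^sup>+\<^sup>1\<close> vanishes on the sphere, and its
  derivative in the direction \<open>u\<close> is \<open>\<phi>'(X) Q\<^sup>k\<^sup>+\<^sup>1 - 2 (k + 1) X \<phi>(X) Q\<^sup>k\<close>. The identity works for every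
  unit vector \<open>u\<close> at once, which replaces the rotation invariance of the ball.
\<close>

lemma ball_integral_by_parts:
  fixes \<phi> \<phi>' :: "real \<Rightarrow> real"
  assumes u: "norm_R n u = 1"
    and deriv: "\<And>t. (\<phi> has_real_derivative \<phi>' t) (at t)"
    and cont: "continuous_on UNIV \<phi>'"
  shows "ball_integral n (\<lambda>x. \<phi>' (inner_R n x u) * (1 - (norm_R n x)\<^sup>2) ^ Suc k) =
    2 * real (Suc k) * ball_integral n (\<lambda>x. inner_R n x u * \<phi> (inner_R n x u) * (1 - (norm_R n x)\<^sup>2) ^ k)"
proof -
  let ?X = "\<lambda>x::nat \<Rightarrow> real. inner_R n x u" and ?Q = "\<lambda>x::nat \<Rightarrow> real. 1 - (norm_R n x)\<^sup>2"
  have c\<phi>: "continuous_on UNIV \<phi>"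
    using deriv by (intro DERIV_continuous_on) auto
  have [continuous_intros]: "continuous_on UNIV (\<lambda>x. \<phi> (?X x))" "continuous_on UNIV (\<lambda>x. \<phi>' (?X x))"
    by (rule continuous_on_compose2[OF c\<phi> continuous_on_inner_R] continuous_on_compose2[OF cont continuous_on_inner_R]; simp)+
  have partial: "u i * ball_integral n (\<lambda>x. u i * \<phi>' (?X x) * ?Q x ^ Suc k
       - 2 * real (Suc k) * x i * \<phi> (?X x) * ?Q x ^ k) = 0" if i: "i < n" for i
  proof -
    have "ball_integral n (\<lambda>x. u i * \<phi>' (?X x) * ?Q x ^ Suc k
       - 2 * real (Suc k) * x i * \<phi> (?X x) * ?Q x ^ k) = 0"
    proof (rule ball_integral_partial_derivative[OF i])
      fix x :: "nat \<Rightarrow> real" and s :: real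
      define b where "b = (\<Sum>j\<in>{..<n}-{i}. x j * u j)"
      define q where "q = (\<Sum>j\<in>{..<n}-{i}. (x j)\<^sup>2)"
      have "((\<lambda>s. \<phi> (s * u i + b) * (1 - (s\<^sup>2 + q)) ^ Suc k) has_real_derivative
         u i * \<phi>' (s * u i + b) * (1 - (s\<^sup>2 + q)) ^ Suc k
       - 2 * real (Suc k) * s * \<phi> (s * u i + b) * (1 - (s\<^sup>2 + q)) ^ k) (at s)"
        by (rule derivative_eq_intros DERIV_chain2[OF deriv] refl)+ (simp add: algebra_simps)
      then show "((\<lambda>s. \<phi> (?X (x(i := s))) * ?Q (x(i := s)) ^ Suc k) has_real_derivative
         u i * \<phi>' (?X (x(i := s))) * ?Q (x(i := s)) ^ Suc k
       - 2 * real (Suc k) * (x(i := s)) i * \<phi> (?X (x(i := s))) * ?Q (x(i := s)) ^ k) (at s)"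
        by (simp only: inner_R_fun_upd[OF i] norm_R_fun_upd[OF i] b_def q_def fun_upd_same)
    next
      show "continuous_on UNIV (\<lambda>x::nat \<Rightarrow> real. u i * \<phi>' (?X x) * ?Q x ^ Suc k
       - 2 * real (Suc k) * x i * \<phi> (?X x) * ?Q x ^ k)"
        by (intro continuous_intros)
    qed simp
    then show ?thesis by simp
  qed
  have eq: "(\<lambda>x. \<Sum>i<n. u i * (u i * \<phi>' (?X x) * ?Q x ^ Suc k
       - 2 * real (Suc k) * x i * \<phi> (?X x) * ?Q x ^ k)) =
     (\<lambda>x. \<phi>' (?X x) * ?Q x ^ Suc k - 2 * real (Suc k) * (?X x * \<phi> (?X x) * ?Q x ^ k))"
  proof
    fix x :: "nat \<Rightarrow> real"
    have "(\<Sum>i<n. u i * (u i * \<phi>' (?X x) * ?Q x ^ Suc k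
       - 2 * real (Suc k) * x i * \<phi> (?X x) * ?Q x ^ k)) =
      (\<Sum>i<n. (u i)\<^sup>2) * (\<phi>' (?X x) * ?Q x ^ Suc k) - (\<Sum>i<n. x i * u i) * (2 * real (Suc k) * \<phi> (?X x) * ?Q x ^ k)"
      unfolding sum_distrib_right sum_subtractf[symmetric]
      by (rule sum.cong) (auto simp: algebra_simps power2_eq_square)
    also have "(\<Sum>i<n. (u i)\<^sup>2) = 1" using u norm_R_sq[of n u] by simp
    finally show "(\<Sum>i<n. u i * (u i * \<phi>' (?X x) * ?Q x ^ Suc k
       - 2 * real (Suc k) * x i * \<phi> (?X x) * ?Q x ^ k)) =
      \<phi>' (?X x) * ?Q x ^ Suc k - 2 * real (Suc k) * (?X x * \<phi> (?X x) * ?Q x ^ k)"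
      unfolding inner_R_def[of n x u, symmetric] by (simp only: mult_1_left mult_ac)
  qed
  have "0 = (\<Sum>i<n. u i * ball_integral n (\<lambda>x. u i * \<phi>' (?X x) * ?Q x ^ Suc k
       - 2 * real (Suc k) * x i * \<phi> (?X x) * ?Q x ^ k))"
    by (rule sum.neutral[symmetric]) (use partial in blast)
  also have "\<dots> = ball_integral n (\<lambda>x. \<Sum>i<n. u i * (u i * \<phi>' (?X x) * ?Q x ^ Suc k
       - 2 * real (Suc k) * x i * \<phi> (?X x) * ?Q x ^ k))"
    unfolding ball_integral_cmult[symmetric]
    by (rule ball_integral_sum[symmetric]) (intro continuous_intros)
  also have "\<dots> = ball_integral n (\<lambda>x. \<phi>' (?X x) * ?Q x ^ Suc k)
      - 2 * real (Suc k) * ball_integral n (\<lambda>x. ?X x * \<phi> (?X x) * ?Q x ^ k)"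
    unfolding eq by (subst ball_integral_diff) (auto simp del: power_Suc simp: ball_integral_cmult intro!: continuous_intros)
  finally show ?thesis by simp
qed

text \<open>
  Integration by parts with \<open>\<phi>(t) = t\<close> in each coordinate direction, summed over the coordinates,
  where \<open>\<Sum>x\<^sub>i\<^sup>2 = 1 - Q\<close>.
\<close>

lemma ball_integral_power_recursion:
  "(n + 2 * Suc k) * ball_integral n (\<lambda>x. (1 - (norm_R n x)\<^sup>2) ^ Suc k) =
    2 * real (Suc k) * ball_integral n (\<lambda>x. (1 - (norm_R n x)\<^sup>2) ^ k)"
proof -
  let ?Q = "\<lambda>x::nat \<Rightarrow> real. 1 - (norm_R n x)\<^sup>2"
  have 1: "ball_integral n (\<lambda>x. ?Q x ^ Suc k) = 2 * real (Suc k) * ball_integral n (\<lambda>x. (x i)\<^sup>2 * ?Q x ^ k)"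
    if "i < n" for i
    using ball_integral_by_parts[OF norm_R_basis[OF that], of "\<lambda>t. t" "\<lambda>t. 1" k] that
    by (simp add: inner_R_basis power2_eq_square del: power_Suc of_nat_Suc)
  have "n * ball_integral n (\<lambda>x. ?Q x ^ Suc k) = (\<Sum>i<n. ball_integral n (\<lambda>x. ?Q x ^ Suc k))"
    by simp
  also have "\<dots> = 2 * real (Suc k) * (\<Sum>i<n. ball_integral n (\<lambda>x. (x i)\<^sup>2 * ?Q x ^ k))"
    unfolding sum_distrib_left by (rule sum.cong) (auto simp: 1 simp del: power_Suc of_nat_Suc)
  also have "(\<Sum>i<n. ball_integral n (\<lambda>x. (x i)\<^sup>2 * ?Q x ^ k)) =
      ball_integral n (\<lambda>x. \<Sum>i<n. (x i)\<^sup>2 * ?Q x ^ k)"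
    by (rule ball_integral_sum[symmetric]) (intro continuous_intros)
  also have "(\<lambda>x. \<Sum>i<n. (x i)\<^sup>2 * ?Q x ^ k) = (\<lambda>x. ?Q x ^ k - ?Q x ^ Suc k)"
    by (simp add: sum_distrib_right[symmetric] norm_R_sq[symmetric] algebra_simps)
  also have "ball_integral n \<dots> = ball_integral n (\<lambda>x. ?Q x ^ k) - ball_integral n (\<lambda>x. ?Q x ^ Suc k)"
    by (rule ball_integral_diff) (intro continuous_intros)+
  finally show ?thesis by (simp add: algebra_simps del: power_Suc)
qed

context
  fixes n :: nat and u :: "nat \<Rightarrow> real"
  assumes u: "norm_R n u = 1"
begin

lemma ball_moment_1: "ball_integral n (\<lambda>x. inner_R n x u) = 0"
  using ball_integral_by_parts[OF u, of "\<lambda>t. 1" "\<lambda>t. 0" 0] by (simp add: ball_integral_def)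

lemma ball_moment_2: "ball_integral n (\<lambda>x. (inner_R n x u)\<^sup>2) = vol_R n (cball_R n) / (n + 2)"
  using ball_integral_by_parts[OF u, of "\<lambda>t. t" "\<lambda>t. 1" 0] ball_integral_power_recursion[of n 0]
  by (simp add: power2_eq_square ball_integral_1 field_simps)

text \<open>
  The chain is \<open>\<integral>X\<^sup>4 = 3/2 \<integral>X\<^sup>2 Q\<close>, \<open>\<integral>X\<^sup>2 Q = 1/4 \<integral>Q\<^sup>2\<close>, and the recursion for the powers of \<open>Q\<close>.
  What matters is the order \<open>n\<^sup>-\<^sup>2\<close>, the square of the order of the second moment.
\<close>

lemma ball_moment_4:
  "ball_integral n (\<lambda>x. (inner_R n x u) ^ 4) = 3 * vol_R n (cball_R n) / ((n + 2) * (n + 4))"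
proof -
  let ?X = "\<lambda>x::nat \<Rightarrow> real. inner_R n x u" and ?Q = "\<lambda>x::nat \<Rightarrow> real. 1 - (norm_R n x)\<^sup>2"
  have "((\<lambda>t. t ^ 3) has_real_derivative 3 * t\<^sup>2) (at t)" for t :: real
    by (rule derivative_eq_intros refl)+ simp
  from ball_integral_by_parts[OF u this, of 0]
  have 1: "3 * ball_integral n (\<lambda>x. (?X x)\<^sup>2 * ?Q x) = 2 * ball_integral n (\<lambda>x. (?X x) ^ 4)"
    by (simp add: continuous_intros power_numeral_reduce mult.assoc ball_integral_cmult)
  have 2: "ball_integral n (\<lambda>x. ?Q x ^ 2) = 4 * ball_integral n (\<lambda>x. (?X x)\<^sup>2 * ?Q x)"
    using ball_integral_by_parts[OF u, of "\<lambda>t. t" "\<lambda>t. 1" 1] by (simp add: power2_eq_square)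
  have 3: "(n + 4) * ball_integral n (\<lambda>x. ?Q x ^ 2) = 4 * ball_integral n (\<lambda>x. ?Q x)"
    using ball_integral_power_recursion[of n 1] by (simp add: power2_eq_square)
  have 4: "(n + 2) * ball_integral n (\<lambda>x. ?Q x) = 2 * vol_R n (cball_R n)"
    using ball_integral_power_recursion[of n 0] by (simp add: ball_integral_1)
  have "ball_integral n (\<lambda>x. ?Q x) = 2 * vol_R n (cball_R n) / (n + 2)"
    using 4 by (simp add: eq_divide_eq mult.commute)
  moreover have "ball_integral n (\<lambda>x. ?Q x ^ 2) = 4 * ball_integral n (\<lambda>x. ?Q x) / (n + 4)"
    using 3 by (simp add: eq_divide_eq mult.commute)
  ultimately have "ball_integral n (\<lambda>x. ?Q x ^ 2) = 8 * vol_R n (cball_R n) / ((n + 2) * (n + 4))"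
    by (simp add: algebra_simps)
  then show ?thesis using 1 2 by simp
qed

text \<open>
  The second moment of \<open>X = \<langle>x, u\<rangle>\<close> has order \<open>1/n\<close> and the fourth has order \<open>1/n\<^sup>2\<close>, so \<open>X\<close> cannot be
  concentrated on rare large values and its mean absolute value has order \<open>1/\<surd>n\<close>. The positive part
  carries half of it because \<open>X\<close> has mean zero.
\<close>

lemma ball_positive_part_lower_bound:
  assumes "1 \<le> n"
  shows "vol_R n (cball_R n) / (27 * sqrt n) \<le> ball_integral n (\<lambda>x. max 0 (inner_R n x u))"
proof -
  let ?X = "\<lambda>x. inner_R n x u"
  define l where "l = 3 / sqrt n"
  have l: "l > 0" "l\<^sup>2 = 9 / n" using assms by (auto simp: l_def power_divide)
  define V where "V = vol_R n (cball_R n)"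
  have V: "V \<ge> 0" by (simp add: V_def vol_R_def)
  \<comment> \<open>A minorant of the positive part by a polynomial of degree four, whose integral is known. The
    truncation level \<open>l\<close> is a multiple of the standard deviation, large enough for the quadratic
    term to dominate the quartic one.\<close>
  have pt: "1 / 2 * (t + 1 / l * (t\<^sup>2 - 1 / l\<^sup>2 * t ^ 4)) \<le> max 0 t" for t :: real
  proof -
    have "1 / l * (t\<^sup>2 - 1 / l\<^sup>2 * t ^ 4) \<le> \<bar>t\<bar>"
    proof (cases "\<bar>t\<bar> \<le> l")
      case True
      have "1 / l * (t\<^sup>2 - 1 / l\<^sup>2 * t ^ 4) \<le> 1 / l * t\<^sup>2"
        using l by (intro mult_left_mono) auto
      also have "\<dots> = \<bar>t\<bar> * (\<bar>t\<bar> / l)" by (simp add: power2_eq_square)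
      also have "\<dots> \<le> \<bar>t\<bar> * 1" using True l by (intro mult_left_mono) auto
      finally show ?thesis by simp
    next
      case False
      then have "l\<^sup>2 \<le> t\<^sup>2" using l by (metis abs_le_square_iff abs_of_pos linear)
      then have "l\<^sup>2 * t\<^sup>2 \<le> t\<^sup>2 * t\<^sup>2" by (intro mult_right_mono) auto
      then have "t\<^sup>2 - 1 / l\<^sup>2 * t ^ 4 \<le> 0"
        using l(1) by (simp add: field_simps power_numeral_reduce)
      then have "1 / l * (t\<^sup>2 - 1 / l\<^sup>2 * t ^ 4) \<le> 0"
        using l by (intro mult_nonneg_nonpos) auto
      then show ?thesis by linarith
    qed
    then show ?thesis by (auto simp: max_def)
  qed
  have "V / (27 * sqrt n) \<le> V * (sqrt n / (9 * (n + 2)))"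
  proof -
    have "1 / (27 * sqrt n) = sqrt n / (27 * n)"
      using assms by (simp add: divide_simps)
    also have "\<dots> \<le> sqrt n / (9 * (n + 2))"
      using assms by (intro divide_left_mono) auto
    finally have "1 / (27 * sqrt n) \<le> sqrt n / (9 * (n + 2))" .
    from mult_left_mono[OF this V] show ?thesis by simp
  qed
  also have "\<dots> \<le> 1 / 2 * (0 + 1 / l * (V / (n + 2) - 1 / l\<^sup>2 * (3 * V / ((n + 2) * (n + 4)))))"
  proof -
    have "real n / 9 * (3 / (real n + 4)) \<le> 1 / 3" by (simp add: field_simps)
    then have "1 / (real n + 2) * (1 - real n / 9 * (3 / (real n + 4))) \<ge> 1 / (real n + 2) * (2 / 3)"
      by (intro mult_left_mono) auto
    moreover have "1 / a * (1 - c * (3 / b)) = 1 / a - c * (3 / (a * b))" "1 / a * (2 / 3) = 2 / (3 * a)"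
      for a b c :: real
      by (simp_all add: right_diff_distrib)
    ultimately have "1 / (real n + 2) - real n / 9 * (3 / ((real n + 2) * (real n + 4))) \<ge> 2 / (3 * (real n + 2))"
      by (simp only:)
    then have "1 / 2 * (sqrt n / 3 * (V * (1 / (real n + 2) - real n / 9 * (3 / ((real n + 2) * (real n + 4)))))) \<ge>
       1 / 2 * (sqrt n / 3 * (V * (2 / (3 * (real n + 2)))))"
      using V by (intro mult_left_mono) auto
    then show ?thesis unfolding l(2) by (simp add: l_def field_simps)
  qed
  also have "\<dots> = ball_integral n (\<lambda>x. 1 / 2 * (?X x + 1 / l * ((?X x)\<^sup>2 - 1 / l\<^sup>2 * ?X x ^ 4)))"
    unfolding ball_integral_cmult V_def
    by (subst ball_integral_add ball_integral_cmult ball_integral_diff ball_moment_1 ball_moment_2 ball_moment_4;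
      (intro continuous_intros)?)+ simp
  also have "\<dots> \<le> ball_integral n (\<lambda>x. max 0 (?X x))"
    unfolding ball_integral_def
    by (intro integral_mono integrable_on_cball_R continuous_intros mult_left_mono pt) auto
  finally show ?thesis unfolding V_def .
qed

end

section \<open>The mean of the Minkowski functional and the surface area of a body around a ball\<close>

lemma convex_RD:
  "convex_R A \<Longrightarrow> x \<in> A \<Longrightarrow> y \<in> A \<Longrightarrow> 0 \<le> u \<Longrightarrow> 0 \<le> v \<Longrightarrow> u + v = 1 \<Longrightarrow>
    (\<lambda>i. u * x i + v * y i) \<in> A"
  unfolding convex_R_def by blast

lemma zero_in_cball_R: "(\<lambda>i. 0) \<in> cball_R n"
  by (simp add: cball_R_eq norm_R_def)

lemma inner_R_le_norm: "inner_R n x y \<le> norm_R n x * norm_R n y"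
proof -
  have "inner_R n x y \<le> (\<Sum>i<n. \<bar>x i\<bar> * \<bar>y i\<bar>)"
    unfolding inner_R_def by (intro sum_mono) (simp add: abs_mult[symmetric])
  also have "\<dots> \<le> norm_R n x * norm_R n y"
    unfolding norm_R_eq_L2_set by (rule L2_set_mult_ineq)
  finally show ?thesis .
qed

lemma norm_R_eq_0_iff:
  assumes "x \<in> topspace (Euclidean_space n)"
  shows "norm_R n x = 0 \<longleftrightarrow> x = (\<lambda>i. 0)"
proof
  assume "norm_R n x = 0"
  then have "x i = 0" if "i < n" for i
    using that by (simp add: norm_R_eq_L2_set L2_set_eq_0_iff)
  then show "x = (\<lambda>i. 0)"
    using assms by (auto simp: fun_eq_iff topspace_Euclidean_space) (meson not_le)
qed (simp add: norm_R_def)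

lemma normalize_R_eq: "normalize_R n x = (\<lambda>i. inverse (norm_R n x) * x i)"
  by (auto simp: normalize_R_def divide_inverse mult.commute)

lemma norm_normalize_R: "norm_R n (normalize_R n x) \<le> 1"
  unfolding normalize_R_eq norm_R_scale by (cases "norm_R n x = 0") simp_all

lemma normalize_R_in: "x \<in> topspace (Euclidean_space n) \<Longrightarrow> normalize_R n x \<in> topspace (Euclidean_space n)"
  by (simp add: topspace_Euclidean_space normalize_R_def)

text \<open>
  The measure on the sphere is the image of the uniform measure on the ball under radial
  projection, so the mean over the sphere becomes an integral over the ball.
\<close>

lemma M_mean_eq_ball_integral:
  assumes "1 \<le> n" and f[measurable]: "minkowski_functional K \<in> borel_measurable borel"
  shows "M_mean n K =
    ball_integral n (\<lambda>x. minkowski_functional K (normalize_R n x)) / vol_R n (cball_R n)"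
proof -
  let ?V = "vol_R n (cball_R n)"
  have V: "0 < ?V" by (rule vol_cball_pos[OF assms(1)])
  have "emeasure (lborel_R n) (cball_R n) = ennreal ?V"
    unfolding vol_R_def
    by (rule emeasure_eq_ennreal_measure)
      (use emeasure_compact_R[OF compact_cball_R cball_R_subset, of n] in auto)
  then have um: "uniform_measure (lborel_R n) (cball_R n) =
      density (lborel_R n) (\<lambda>x. ennreal (indicator (cball_R n) x / ?V))"
    unfolding uniform_measure_def
    by (intro density_cong) (auto simp: divide_ennreal V ennreal_indicator[symmetric])
  have [measurable]: "normalize_R n \<in> borel_measurable borel"
    by (rule measurable_normalize_R)
  have "M_mean n K = (LINT x|uniform_measure (lborel_R n) (cball_R n). minkowski_functional K (normalize_R n x))"
    unfolding M_mean_def sphere_measure_def by (rule integral_distr) measurable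
  also have "\<dots> = (LINT x|lborel_R n. (indicator (cball_R n) x / ?V) *\<^sub>R minkowski_functional K (normalize_R n x))"
    unfolding um using V by (intro integral_density) auto
  also have "\<dots> = (LINT x|lborel_R n. indicator (cball_R n) x * minkowski_functional K (normalize_R n x) / ?V)"
    by simp
  also have "\<dots> = ball_integral n (\<lambda>x. minkowski_functional K (normalize_R n x)) / ?V"
    unfolding ball_integral_def by (rule integral_divide_zero)
  finally show ?thesis .
qed

text \<open>
  Convex bodies around the origin: \<open>r\<close> is the radius of a ball that the body contains. Every centered
  body is of this kind, by the lemma \<open>centered_contains_ball\<close> below.
\<close>

context
  fixes n :: nat and K :: "(nat \<Rightarrow> real) set" and r :: real
  assumes K: "compact K" "K \<subseteq> topspace (Euclidean_space n)" "convex_R K"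
    and r: "0 < r" "scale_set r (cball_R n) \<subseteq> K"
begin

lemma mem_of_contains_ball: 
  assumes "x \<in> topspace (Euclidean_space n)" "norm_R n x \<le> r"
  shows "x \<in> K"
proof -
  have "(\<lambda>i. inverse r * x i) \<in> cball_R n"
    unfolding cball_R_def mem_Collect_eq norm_R_scale
    using assms r by (simp add: topspace_Euclidean_space field_simps)
  then have "(\<lambda>i. r * (inverse r * x i)) \<in> scale_set r (cball_R n)"
    unfolding scale_set_def by (rule imageI)
  moreover have "(\<lambda>i. r * (inverse r * x i)) = x" using r by auto
  ultimately show ?thesis using r by auto
qed

lemma zero_mem_of_contains_ball: "(\<lambda>i. 0) \<in> K"
  using r(1) by (intro mem_of_contains_ball) (auto simp: topspace_Euclidean_space norm_R_def)

lemma scale_set_mono: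
  assumes "0 \<le> t" "t \<le> q"
  shows "scale_set t K \<subseteq> scale_set q K"
proof
  fix x assume "x \<in> scale_set t K"
  then obtain y where y: "y \<in> K" "x = (\<lambda>i. t * y i)" by (auto simp: scale_set_def)
  show "x \<in> scale_set q K"
  proof (cases "q = 0")
    case True then show ?thesis using assms y by (auto simp: scale_set_def)
  next
    case False
    have "(\<lambda>i. t / q * y i + (1 - t / q) * 0) \<in> K"
      using False assms by (intro convex_RD[OF K(3) y(1) zero_mem_of_contains_ball]) (auto simp: field_simps)
    then have "(\<lambda>i. q * (t / q * y i + (1 - t / q) * 0)) \<in> scale_set q K"
      unfolding scale_set_def by (rule imageI)
    then show ?thesis using False y by simp
  qed
qed

lemma mem_scale_norm:
  assumes "x \<in> topspace (Euclidean_space n)"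
  shows "x \<in> scale_set (norm_R n x / r) K"
proof (cases "norm_R n x = 0")
  case True
  then have "x = (\<lambda>i. 0)" using assms by (simp add: norm_R_eq_0_iff)
  moreover have "(\<lambda>i. 0 * (0::real)) \<in> scale_set 0 K"
    unfolding scale_set_def by (rule imageI[OF zero_mem_of_contains_ball])
  ultimately show ?thesis using True by simp
next
  case False
  then have pos: "norm_R n x > 0" by (simp add: less_le)
  have "(\<lambda>i. (r / norm_R n x) * x i) \<in> K"
  proof (rule mem_of_contains_ball)
    show "(\<lambda>i. (r / norm_R n x) * x i) \<in> topspace (Euclidean_space n)"
      using assms by (simp add: topspace_Euclidean_space)
    show "norm_R n (\<lambda>i. (r / norm_R n x) * x i) \<le> r"
      unfolding norm_R_scale using pos r(1) by simp
  qed
  then have "(\<lambda>i. norm_R n x / r * (r / norm_R n x * x i)) \<in> scale_set (norm_R n x / r) K"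
    unfolding scale_set_def by (rule imageI)
  moreover have "(\<lambda>i. norm_R n x / r * (r / norm_R n x * x i)) = x"
    using pos r by auto
  ultimately show ?thesis by simp
qed

lemma minkowski_functional_le_norm:
  assumes "x \<in> topspace (Euclidean_space n)"
  shows "minkowski_functional K x \<le> norm_R n x / r"
  unfolding minkowski_functional_def
  using mem_scale_norm[OF assms] r
  by (intro cInf_lower) (auto intro!: bdd_belowI[of _ 0])

lemma minkowski_functional_greatest:
  assumes "x \<in> topspace (Euclidean_space n)"
    and "\<And>t. 0 \<le> t \<Longrightarrow> x \<in> scale_set t K \<Longrightarrow> c \<le> t"
  shows "c \<le> minkowski_functional K x"
  unfolding minkowski_functional_def
  using mem_scale_norm[OF assms(1)] r assms(2)
  by (intro cInf_greatest) (auto intro!: exI[of _ "norm_R n x / r"])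

lemma minkowski_functional_nonneg:
  "x \<in> topspace (Euclidean_space n) \<Longrightarrow> 0 \<le> minkowski_functional K x"
  by (rule minkowski_functional_greatest)

lemma inner_R_le_minkowski_functional:
  assumes x: "x \<in> topspace (Euclidean_space n)" and h: "0 < h" "\<And>y. y \<in> K \<Longrightarrow> inner_R n y u \<le> h"
  shows "inner_R n x u \<le> h * minkowski_functional K x"
proof -
  have "inner_R n x u / h \<le> minkowski_functional K x"
  proof (rule minkowski_functional_greatest[OF x])
    fix t :: real assume t: "0 \<le> t" "x \<in> scale_set t K"
    then obtain y where y: "y \<in> K" "x = (\<lambda>i. t * y i)" by (auto simp: scale_set_def)
    have "inner_R n x u = t * inner_R n y u" by (simp add: y inner_R_scale)
    also have "\<dots> \<le> t * h" using t y h by (intro mult_left_mono) auto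
    finally show "inner_R n x u / h \<le> t" using h by (simp add: field_simps)
  qed
  then show ?thesis using h by (simp add: field_simps)
qed

text \<open>
  Inside \<open>\<real>\<^sup>n\<close> a strict sublevel set is the union of the rational dilates \<open>q K\<close> below that level, as the
  dilates increase with \<open>q\<close>. Outside \<open>\<real>\<^sup>n\<close> the functional is the infimum of the empty set, a constant.
\<close>

lemma measurable_minkowski_functional: "minkowski_functional K \<in> borel_measurable borel"
proof (subst borel_measurable_iff_less, intro allI)
  fix a :: real
  let ?E = "topspace (Euclidean_space n)"
  let ?U = "\<Union>q\<in>{q \<in> \<rat>. 0 \<le> q \<and> q < a}. scale_set q K"
  have E: "?E \<in> sets borel" using closed_Euclidean_R by simp
  have "countable {q::real. q \<in> \<rat> \<and> 0 \<le> q \<and> q < a}"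
    using countable_rat by (rule countable_subset[rotated]) auto
  then have U: "?U \<in> sets borel"
    by (intro sets.countable_UN' image_subsetI borel_compact compact_scale_set[OF K(1)])
  have outside: "minkowski_functional K x = Inf {}" if "x \<notin> ?E" for x
  proof -
    have "{t. 0 \<le> t \<and> x \<in> scale_set t K} = {}"
      using that scale_set_subset[OF K(2)] by blast
    then show ?thesis by (simp only: minkowski_functional_def)
  qed
  have inside: "minkowski_functional K x < a \<longleftrightarrow> x \<in> ?U" if "x \<in> ?E" for x
  proof -
    have "minkowski_functional K x < a \<longleftrightarrow> (\<exists>t. 0 \<le> t \<and> x \<in> scale_set t K \<and> t < a)"
      unfolding minkowski_functional_def using mem_scale_norm[OF that] r
      by (subst cInf_less_iff) (auto intro!: bdd_belowI[of _ 0] exI[of _ "norm_R n x / r"])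
    also have "\<dots> \<longleftrightarrow> x \<in> ?U"
    proof
      assume "\<exists>t. 0 \<le> t \<and> x \<in> scale_set t K \<and> t < a"
      then obtain t where t: "0 \<le> t" "x \<in> scale_set t K" "t < a" by blast
      then obtain q where q: "q \<in> \<rat>" "t < q" "q < a" using Rats_dense_in_real by blast
      then have "x \<in> scale_set q K" using scale_set_mono[of t q] t by auto
      then show "x \<in> ?U" using q t by (intro UN_I[of q]) auto
    qed blast
    finally show ?thesis .
  qed
  have "{x \<in> space borel. minkowski_functional K x < a} =
      (?U \<inter> ?E) \<union> (if (Inf {} :: real) < a then - ?E else {})"
  proof (rule set_eqI)
    fix x
    show "x \<in> {x \<in> space borel. minkowski_functional K x < a} \<longleftrightarrow>
        x \<in> (?U \<inter> ?E) \<union> (if (Inf {} :: real) < a then - ?E else {})"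
      by (cases "x \<in> ?E") (use inside[of x] outside[of x] in simp_all)
  qed
  moreover have "\<dots> \<in> sets borel" using U E by (auto simp: sets.compl_sets)
  ultimately show "{x \<in> space borel. minkowski_functional K x < a} \<in> sets borel" by metis
qed

lemma integrable_minkowski_functional_normalize:
  "integrable (lborel_R n)
    (\<lambda>x. indicator (cball_R n) x * minkowski_functional K (normalize_R n x))"
proof (rule integrable_bounded_on_compact_R[OF compact_cball_R cball_R_subset, where B = "1 / r"])
  show "(\<lambda>x. minkowski_functional K (normalize_R n x)) \<in> borel_measurable borel"
    using measurable_compose[OF measurable_normalize_R measurable_minkowski_functional] .
  fix x assume "x \<in> cball_R n"
  then have x: "normalize_R n x \<in> topspace (Euclidean_space n)"
    using cball_R_subset normalize_R_in by blast
  have "minkowski_functional K (normalize_R n x) \<le> norm_R n (normalize_R n x) / r"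
    by (rule minkowski_functional_le_norm[OF x])
  also have "\<dots> \<le> 1 / r" using r norm_normalize_R by (intro divide_right_mono) auto
  finally show "\<bar>minkowski_functional K (normalize_R n x)\<bar> \<le> 1 / r"
    using minkowski_functional_nonneg[OF x] by simp
qed

text \<open>
  If \<open>K\<close> lies in the half-space \<open>\<langle>y, u\<rangle> \<le> h\<close> then \<open>\<parallel>\<xi>\<parallel>\<^sub>K \<ge> \<langle>\<xi>, u\<rangle>/h\<close>. For \<open>\<xi> = x/\<bar>x\<bar>\<close> with \<open>x\<close> in the unit
  ball the right-hand side only decreases, where it is positive, if \<open>\<xi>\<close> is replaced by \<open>x\<close>. So the mean
  over the sphere is bounded below by the mean of a positive part over the ball.
\<close>

lemma M_mean_lower_bound:
  assumes n: "1 \<le> n" and u: "norm_R n u = 1" and h: "0 < h" "\<And>y. y \<in> K \<Longrightarrow> inner_R n y u \<le> h"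
  shows "1 / (27 * sqrt n) \<le> h * M_mean n K"
proof -
  let ?V = "vol_R n (cball_R n)"
  have V: "0 < ?V" by (rule vol_cball_pos[OF n])
  have pt: "max 0 (inner_R n x u) \<le> h * minkowski_functional K (normalize_R n x)" if x: "x \<in> cball_R n" for x
  proof -
    have xE: "x \<in> topspace (Euclidean_space n)" and x1: "norm_R n x \<le> 1"
      using x by (auto simp: cball_R_def)
    note nE = normalize_R_in[OF xE]
    have "inner_R n x u \<le> h * minkowski_functional K (normalize_R n x)" if pos: "0 < inner_R n x u"
    proof -
      have "0 < norm_R n x" using inner_R_le_norm[of n x u] u pos by simp
      then have "inner_R n x u \<le> inverse (norm_R n x) * inner_R n x u"
        using x1 pos by (simp add: field_simps)
      also have "\<dots> = inner_R n (normalize_R n x) u" by (simp add: normalize_R_eq inner_R_scale)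
      also have "\<dots> \<le> h * minkowski_functional K (normalize_R n x)"
        by (rule inner_R_le_minkowski_functional[OF nE h])
      finally show ?thesis .
    qed
    moreover have "0 \<le> h * minkowski_functional K (normalize_R n x)"
      using minkowski_functional_nonneg[OF nE] h by simp
    ultimately show ?thesis by (cases "0 < inner_R n x u") auto
  qed
  have "?V / (27 * sqrt n) \<le> ball_integral n (\<lambda>x. max 0 (inner_R n x u))"
    by (rule ball_positive_part_lower_bound[OF u n])
  also have "\<dots> \<le> ball_integral n (\<lambda>x. h * minkowski_functional K (normalize_R n x))"
    unfolding ball_integral_def
  proof (rule integral_mono)
    show "integrable (lborel_R n) (\<lambda>x. indicator (cball_R n) x * max 0 (inner_R n x u))"
      by (intro integrable_on_cball_R continuous_intros)
    show "integrable (lborel_R n)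
     (\<lambda>x. indicator (cball_R n) x * (h * minkowski_functional K (normalize_R n x)))"
      using integrable_mult_right[OF integrable_minkowski_functional_normalize, of h]
      by (simp add: mult.left_commute)
  next
    fix x
    show "indicator (cball_R n) x * max 0 (inner_R n x u)
        \<le> indicator (cball_R n) x * (h * minkowski_functional K (normalize_R n x))"
      using pt[of x] by (cases "x \<in> cball_R n") simp_all
  qed
  also have "\<dots> = h * (M_mean n K * ?V)"
    using V unfolding ball_integral_cmult M_mean_eq_ball_integral[OF n measurable_minkowski_functional] by simp
  finally have "?V * (1 / (27 * sqrt n)) \<le> ?V * (h * M_mean n K)" by (simp add: mult_ac)
  then show ?thesis using V by (simp only: mult_le_cancel_left_pos)
qed

lemma minkowski_sum_ball_subset:
  assumes "0 < t"
  shows "minkowski_sum K (scale_set t (cball_R n)) \<subseteq> scale_set (1 + t / r) K"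
proof
  fix p assume "p \<in> minkowski_sum K (scale_set t (cball_R n))"
  then obtain x b where p: "p = (\<lambda>i. x i + t * b i)" "x \<in> K" "b \<in> cball_R n"
    by (auto simp: minkowski_sum_def scale_set_def)
  define s where "s = 1 + t / r"
  have "s > 0" using assms r by (auto simp: s_def intro!: add_pos_nonneg)
  moreover from this have "1 / s + t / r / s = 1"
    unfolding add_divide_distrib[symmetric] s_def[symmetric] by simp
  moreover from \<open>s > 0\<close> have "t / r / s \<ge> 0" "1 / s \<ge> 0"
    using assms r(1) by (simp_all only: divide_nonneg_pos less_imp_le zero_le_one)
  ultimately have s: "s > 0" "1 / s \<ge> 0" "t / r / s \<ge> 0" "1 / s + t / r / s = 1"
    by blast+
  have "(\<lambda>i. r * b i) \<in> K" using p r by (auto simp: scale_set_def)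
  then have "(\<lambda>i. 1 / s * x i + t / r / s * (r * b i)) \<in> K"
    by (rule convex_RD[OF K(3) p(2) _ s(2-4)])
  then have "(\<lambda>i. s * (1 / s * x i + t / r / s * (r * b i))) \<in> scale_set s K"
    unfolding scale_set_def by (rule imageI)
  moreover have "(\<lambda>i. s * (1 / s * x i + t / r / s * (r * b i))) = p"
    using s(1) r by (auto simp: p distrib_left)
  ultimately show "p \<in> scale_set (1 + t / r) K" by (simp add: s_def)
qed

text \<open>
  Since \<open>t B \<subseteq> (t/r) K\<close>, the parallel body \<open>K + t B\<close> lies in \<open>(1 + t/r) K\<close>, and the volume of that
  dilate has derivative \<open>n \<bar>K\<bar>/r\<close> at \<open>t = 0\<close>.
\<close>

lemma surface_area_le: "surface_area n K \<le> ereal (n * vol_R n K / r)"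
proof -
  let ?v = "vol_R n K"
  let ?S = "\<lambda>t. minkowski_sum K (scale_set t (cball_R n))"
  let ?g = "\<lambda>t. ?v * (((1 + t / r) ^ n - 1) / t)"
  have le: "(vol_R n (?S t) - ?v) / t \<le> ?g t" if t: "0 < t" for t
  proof -
    have s: "0 < 1 + t / r" using t r by (simp add: add_pos_nonneg)
    have sub: "scale_set (1 + t / r) K \<subseteq> topspace (Euclidean_space n)"
      "?S t \<subseteq> topspace (Euclidean_space n)"
      using minkowski_sum_ball_subset[OF t] scale_set_subset[OF K(2)] by blast+
    have "vol_R n (?S t) \<le> vol_R n (scale_set (1 + t / r) K)"
      unfolding vol_R_def using K(1)
      by (intro measure_mono_fmeasurable minkowski_sum_ball_subset t fmeasurable_compact_R sub
          compact_scale_set)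
        (auto intro!: borel_compact compact_minkowski_sum compact_scale_set compact_cball_R)
    also have "\<dots> = (1 + t / r) ^ n * ?v"
      using K(1) by (intro vol_scale_set s borel_compact)
    finally have "vol_R n (?S t) - ?v \<le> ?v * ((1 + t / r) ^ n - 1)"
      by (simp add: algebra_simps)
    then show ?thesis using t by (simp add: divide_right_mono)
  qed
  have "((\<lambda>t. (1 + t / r) ^ n) has_real_derivative n / r) (at 0)"
    unfolding divide_inverse by (rule derivative_eq_intros refl)+ simp
  then have "((\<lambda>t. ((1 + t / r) ^ n - 1) / t) \<longlongrightarrow> n / r) (at 0)"
    by (simp add: has_field_derivative_iff)
  then have "((\<lambda>t. ((1 + t / r) ^ n - 1) / t) \<longlongrightarrow> n / r) (at_right 0)"
    by (rule tendsto_mono[rotated]) (simp add: at_le)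
  then have "(?g \<longlongrightarrow> ?v * (n / r)) (at_right 0)"
    by (rule tendsto_mult_left)
  then have lim: "((\<lambda>t. ereal (?g t)) \<longlongrightarrow> ereal (?v * (n / r))) (at_right 0)"
    by simp
  have "surface_area n K \<le> Liminf (at_right 0) (\<lambda>t. ereal (?g t))"
    unfolding surface_area_def
    by (rule Liminf_mono, rule eventually_at_rightI[of 0 1]) (use le in auto)
  also have "\<dots> = ereal (?v * (n / r))"
    by (rule lim_imp_Liminf[OF _ lim]) simp
  finally show ?thesis by (simp add: mult.commute)
qed

end

section \<open>Supporting half-spaces and the inradius of a centered body\<close>

text \<open>
  A point \<open>x\<close> of the ball \<open>r B\<close> outside \<open>K\<close> is separated from \<open>K\<close> by the direction from its nearest
  point \<open>p\<close> in \<open>K\<close> to \<open>x\<close>: a point of \<open>K\<close> beyond \<open>p\<close> in that direction would, by convexity, yield points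
  closer to \<open>x\<close>.
\<close>

lemma separating_direction:
  assumes K: "compact K" "K \<noteq> {}" "K \<subseteq> topspace (Euclidean_space n)" "convex_R K"
    and r: "0 < r" "\<not> scale_set r (cball_R n) \<subseteq> K"
  obtains u where "norm_R n u = 1" "u \<in> topspace (Euclidean_space n)" "\<And>y. y \<in> K \<Longrightarrow> inner_R n y u \<le> r"
proof -
  obtain b where b: "b \<in> cball_R n" "(\<lambda>i. r * b i) \<notin> K" using r(2) by (auto simp: scale_set_def)
  define x where "x = (\<lambda>i. r * b i)"
  have x: "x \<in> topspace (Euclidean_space n)" "norm_R n x \<le> r" "x \<notin> K"
    using b r(1) by (auto simp: x_def cball_R_eq topspace_Euclidean_space norm_R_scale)
  have "continuous_on K (\<lambda>p. norm_R n (\<lambda>i. x i - p i))"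
    unfolding norm_R_def by (intro continuous_intros)
  then obtain p where p: "p \<in> K" and min: "\<And>y. y \<in> K \<Longrightarrow> norm_R n (\<lambda>i. x i - p i) \<le> norm_R n (\<lambda>i. x i - y i)"
    using continuous_attains_inf[OF K(1,2)] by blast
  define w where "w = (\<lambda>i. x i - p i)"
  have wE: "w \<in> topspace (Euclidean_space n)"
    using x p K(3) by (auto simp: w_def topspace_Euclidean_space subset_iff)
  have "w \<noteq> (\<lambda>i. 0)"
    using x(3) p by (auto simp: w_def fun_eq_iff) (metis ext)
  then have w: "0 < norm_R n w" using wE by (simp add: norm_R_eq_0_iff less_le)
  have le: "inner_R n y w \<le> r * norm_R n w" if y: "y \<in> K" for y
  proof -
    define d where "d = (\<lambda>i. y i - p i)"
    \<comment> \<open>Compare \<open>p\<close> with \<open>p + s d\<close>, and let \<open>s\<close> tend to \<open>0\<close> afterwards.\<close>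
    have key: "2 * inner_R n d w \<le> s * (norm_R n d)\<^sup>2" if s: "0 < s" "s \<le> 1" for s
    proof -
      have "(\<lambda>i. (1 - s) * p i + s * y i) \<in> K"
        using s by (intro convex_RD[OF K(4) p y]) auto
      from min[OF this] have "(norm_R n w)\<^sup>2 \<le> (norm_R n (\<lambda>i. x i - ((1 - s) * p i + s * y i)))\<^sup>2"
        unfolding w_def by (intro power_mono) auto
      also have "\<dots> = (\<Sum>i<n. (w i - s * d i)\<^sup>2)"
        unfolding norm_R_sq w_def d_def by (intro sum.cong) (auto simp: algebra_simps)
      also have "\<dots> = (norm_R n w)\<^sup>2 - s * (2 * inner_R n d w) + s * (s * (norm_R n d)\<^sup>2)"
        unfolding norm_R_sq inner_R_def sum_distrib_left sum_subtractf[symmetric] sum.distrib[symmetric]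
        by (intro sum.cong) (auto simp: power2_eq_square algebra_simps)
      finally have "s * (2 * inner_R n d w) \<le> s * (s * (norm_R n d)\<^sup>2)" by simp
      then show ?thesis using s by (simp only: mult_le_cancel_left_pos)
    qed
    have "((\<lambda>s. s * (norm_R n d)\<^sup>2) \<longlongrightarrow> 0 * (norm_R n d)\<^sup>2) (at_right 0)"
      by (intro tendsto_intros)
    then have "2 * inner_R n d w \<le> 0 * (norm_R n d)\<^sup>2"
      by (rule tendsto_lowerbound) (auto intro!: eventually_at_rightI[of 0 1] key)
    then have "inner_R n y w \<le> inner_R n p w"
      by (simp add: inner_R_def d_def left_diff_distrib sum_subtractf)
    also have "\<dots> \<le> inner_R n x w"
    proof -
      have "inner_R n x w - inner_R n p w = (norm_R n w)\<^sup>2"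
        unfolding inner_R_def norm_R_sq w_def sum_subtractf[symmetric]
        by (intro sum.cong) (auto simp: algebra_simps power2_eq_square)
      then show ?thesis by (metis diff_ge_0_iff_ge zero_le_power2)
    qed
    also have "\<dots> \<le> norm_R n x * norm_R n w" by (rule inner_R_le_norm)
    also have "\<dots> \<le> r * norm_R n w" using x(2) by (intro mult_right_mono) auto
    finally show ?thesis .
  qed
  define u where "u = (\<lambda>i. inverse (norm_R n w) * w i)"
  show ?thesis
  proof (rule that[of u])
    show "norm_R n u = 1" using w by (simp add: u_def norm_R_scale)
    show "u \<in> topspace (Euclidean_space n)" using wE by (simp add: u_def topspace_Euclidean_space)
    fix y assume "y \<in> K"
    have "inner_R n y u = inner_R n y w / norm_R n w"
      by (simp add: u_def inner_R_def sum_divide_distrib divide_inverse mult_ac sum_distrib_left)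
    also have "\<dots> \<le> r" using le[OF \<open>y \<in> K\<close>] w by (simp add: field_simps)
    finally show "inner_R n y u \<le> r" .
  qed
qed

lemma convex_body_contains_box:
  assumes "convex_body n K"
  obtains z \<rho> where "0 < \<rho>" "box_R n z \<rho> \<subseteq> K"
proof -
  let ?E = "topspace (Euclidean_space n)"
  obtain z where "z \<in> Euclidean_space n interior_of K" using assms unfolding convex_body_def by blast
  then obtain T where T: "openin (Euclidean_space n) T" "z \<in> T" "T \<subseteq> K"
    by (auto simp: interior_of_def)
  then obtain U where U: "open U" "T = U \<inter> ?E"
    unfolding Euclidean_space_def
    by (auto simp: openin_subtopology euclidean_product_topology)
  have zE: "z \<in> ?E" using T openin_subset by blast
  have oU: "openin (product_topology (\<lambda>i. euclidean) UNIV) U"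
    using U by (simp add: euclidean_product_topology)
  have "z \<in> U" using T(2) U(2) by blast
  from product_topology_open_contains_basis[OF oU this] obtain X where
    X: "z \<in> Pi\<^sub>E UNIV X" "\<forall>i. openin euclidean (X i)" "Pi\<^sub>E UNIV X \<subseteq> U" by blast
  have "\<exists>e>0. ball (z i) e \<subseteq> X i" for i
  proof -
    have "open (X i)" "z i \<in> X i" using X(1,2) by (auto simp: open_openin[symmetric] PiE_def Pi_def)
    then show ?thesis by (rule openE) blast
  qed
  then have "\<forall>i. \<exists>e>0. ball (z i) e \<subseteq> X i" ..
  then obtain e where "\<forall>i. e i > 0 \<and> ball (z i) (e i) \<subseteq> X i"
    using choice[of "\<lambda>i e. e > 0 \<and> ball (z i) e \<subseteq> X i"] by blast
  then have e: "\<And>i. e i > 0" "\<And>i. ball (z i) (e i) \<subseteq> X i" by auto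
  define \<rho> where "\<rho> = Min (insert 1 (e ` {..<n})) / 2"
  have M: "0 < Min (insert 1 (e ` {..<n}))" using e(1) by (subst Min_gr_iff) auto
  then have \<rho>: "0 < \<rho>" by (simp add: \<rho>_def)
  have \<rho>e: "\<rho> < e i" if "i < n" for i
  proof -
    have "Min (insert 1 (e ` {..<n})) \<le> e i" using that by (intro Min_le) auto
    then show ?thesis using M e(1)[of i] unfolding \<rho>_def by linarith
  qed
  have "box_R n z \<rho> \<subseteq> K"
  proof
    fix x assume x: "x \<in> box_R n z \<rho>"
    have "x i \<in> X i" for i
    proof (cases "i < n")
      case True
      then have "\<bar>x i - z i\<bar> < e i" using x \<rho>e[OF True] by (auto simp: box_R_def)
      then show ?thesis using e(2)[of i] by (auto simp: dist_real_def abs_minus_commute subset_iff)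
    next
      case False
      then have "x i = z i" using x zE by (simp add: box_R_def topspace_Euclidean_space)
      then show ?thesis using X(1) by (auto simp: PiE_def Pi_def)
    qed
    then have "x \<in> U" using X(3) by (auto simp: PiE_def Pi_def)
    then show "x \<in> K" using T U x by (auto simp: box_R_def)
  qed
  then show ?thesis using \<rho> that by blast
qed

lemma convex_body_vol_pos: "convex_body n K \<Longrightarrow> 0 < vol_R n K"
  by (metis convex_body_contains_box vol_R_pos_of_box convex_body_compact convex_body_subset)

text \<open>
  Suppose that \<open>K\<close> lies in a half-space \<open>\<langle>y, u\<rangle> \<le> \<delta>\<close>. Because \<open>K\<close> contains a cube of half-width \<open>\<rho>\<close>, the
  functional is at most \<open>\<delta> - \<rho>/2\<close> on the concentric cube of half the size. As its mean over \<open>K\<close> is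
  zero, \<open>\<delta>\<close> cannot be too small, and hence a ball of some radius \<open>\<delta>\<close> lies in \<open>K\<close>.
\<close>

lemma centered_contains_ball:
  assumes n: "1 \<le> n" and K: "convex_body n K" "centered n K"
  obtains r where "0 < r" "scale_set r (cball_R n) \<subseteq> K"
proof -
  note cK = convex_body_compact[OF K(1)] and sK = convex_body_subset[OF K(1)]
  obtain z \<rho> where \<rho>: "0 < \<rho>" and box: "box_R n z \<rho> \<subseteq> K" by (rule convex_body_contains_box[OF K(1)])
  have vol: "0 < vol_R n K" by (rule convex_body_vol_pos[OF K(1)])
  let ?B = "box_R n z (\<rho> / 2)"
  have BK: "?B \<subseteq> K" using box \<rho> by (force simp: box_R_def)
  have vB: "measure (lborel_R n) ?B = \<rho> ^ n"
    using \<rho> by (simp add: measure_def emeasure_box_R)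
  \<comment> \<open>Half of the value for which the comparison of integrals below would be an equality.\<close>
  define \<delta> where "\<delta> = \<rho> / 4 * \<rho> ^ n / vol_R n K"
  have \<delta>: "0 < \<delta>" using \<rho> vol by (simp add: \<delta>_def)
  have "scale_set \<delta> (cball_R n) \<subseteq> K"
  proof (rule ccontr)
    assume "\<not> scale_set \<delta> (cball_R n) \<subseteq> K"
    then obtain u where u: "norm_R n u = 1" "u \<in> topspace (Euclidean_space n)"
      and le: "\<And>y. y \<in> K \<Longrightarrow> inner_R n y u \<le> \<delta>"
      using separating_direction[OF cK _ sK _ \<delta>] K(1) vol unfolding convex_body_def
      by (metis measure_empty vol_R_def less_irrefl)
    have gap: "inner_R n y u \<le> \<delta> - \<rho> / 2" if y: "y \<in> ?B" for y
    proof -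
      have "(\<lambda>i. y i + \<rho> / 2 * u i) \<in> box_R n z \<rho>"
      proof -
        have "\<bar>y i + \<rho> / 2 * u i - z i\<bar> \<le> \<rho>" if "i < n" for i
        proof -
          have "\<bar>\<rho> / 2 * u i\<bar> \<le> \<rho> / 2 * 1"
            unfolding abs_mult using abs_coordinate_le_norm_R[OF that, of u] u \<rho> by (intro mult_mono) auto
          moreover have "\<bar>y i - z i\<bar> \<le> \<rho> / 2" using y that by (auto simp: box_R_def)
          ultimately show ?thesis by linarith
        qed
        then show ?thesis using y u by (auto simp: box_R_def topspace_Euclidean_space)
      qed
      then have "inner_R n (\<lambda>i. y i + \<rho> / 2 * u i) u \<le> \<delta>" using le box by blast
      moreover have "inner_R n (\<lambda>i. y i + \<rho> / 2 * u i) u = inner_R n y u + \<rho> / 2 * (norm_R n u)\<^sup>2"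
        unfolding inner_R_def norm_R_sq sum_distrib_left sum.distrib[symmetric]
        by (intro sum.cong) (auto simp: algebra_simps power2_eq_square)
      ultimately show ?thesis using u by simp
    qed
    have int: "integrable (lborel_R n) (\<lambda>x. indicator K x * f x)" if "continuous_on UNIV f" for f :: "_ \<Rightarrow> real"
      by (rule integrable_continuous_on_compact_R[OF cK sK that])
    have mom: "(LINT x|lborel_R n. indicator K x * x i) = 0" for i
    proof -
      have "barycenter n K i = 0" using K(2) by (simp add: centered_def)
      then show ?thesis using vol by (simp add: barycenter_def set_lebesgue_integral_def)
    qed
    have "(LINT x|lborel_R n. indicator K x * inner_R n x u) = (LINT x|lborel_R n. (\<Sum>i<n. u i * (indicator K x * x i)))"
      by (simp add: inner_R_def sum_distrib_left mult_ac)
    also have "\<dots> = 0"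
      using int[OF continuous_on_coordinate_R] by (subst Bochner_Integration.integral_sum) (auto simp: mom)
    finally have 0: "(LINT x|lborel_R n. indicator K x * inner_R n x u) = 0" .
    have "\<rho> / 2 * \<rho> ^ n = (LINT x|lborel_R n. \<rho> / 2 * indicator ?B x)"
      by (simp add: vB)
    also have "\<dots> \<le> (LINT x|lborel_R n. \<delta> * indicator K x - indicator K x * inner_R n x u)"
    proof (rule integral_mono)
      have "integrable (lborel_R n) (\<lambda>x. indicator ?B x * (\<rho> / 2))"
        by (rule integrable_continuous_on_compact_R[OF compact_box_R]) (auto simp: box_R_def)
      then show "integrable (lborel_R n) (\<lambda>x. \<rho> / 2 * indicator ?B x)"
        by (simp add: mult.commute)
      have "integrable (lborel_R n) (\<lambda>x. indicator K x * (\<delta> - inner_R n x u))"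
        by (rule int) (intro continuous_intros)
      then show "integrable (lborel_R n) (\<lambda>x. \<delta> * indicator K x - indicator K x * inner_R n x u)"
        by (simp add: algebra_simps)
      fix x
      show "\<rho> / 2 * indicator ?B x \<le> \<delta> * indicator K x - indicator K x * inner_R n x u"
        using gap[of x] le[of x] BK by (auto simp: indicator_def)
    qed
    also have "\<dots> = \<delta> * vol_R n K"
      using int[of "\<lambda>x. 1"] int[OF continuous_on_inner_R] by (simp add: 0 vol_R_def)
    also have "\<dots> = \<rho> / 4 * \<rho> ^ n" using vol by (simp add: \<delta>_def)
    finally have "\<rho> / 2 * \<rho> ^ n \<le> \<rho> / 4 * \<rho> ^ n" .
    moreover have "\<rho> / 4 * \<rho> ^ n < \<rho> / 2 * \<rho> ^ n" using \<rho> by (intro mult_strict_right_mono) auto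
    ultimately show False by linarith
  qed
  then show ?thesis using \<delta> that by blast
qed

lemma centered_M_mean_pos:
  assumes n: "1 \<le> n" and K: "convex_body n K" "centered n K"
  shows "0 < M_mean n K"
proof -
  note cK = convex_body_compact[OF K(1)] and sK = convex_body_subset[OF K(1)]
  have vK: "convex_R K" using K(1) by (simp add: convex_body_def)
  obtain r where r: "0 < r" "scale_set r (cball_R n) \<subseteq> K" by (rule centered_contains_ball[OF n K])
  obtain R where R: "0 < R" "K \<subseteq> box_R n (\<lambda>i. 0) R" by (rule compact_subset_box_R[OF cK sK])
  have "inner_R n y (\<lambda>j. if j = 0 then 1 else 0) \<le> R" if "y \<in> K" for y
    using that R n by (subst inner_R_basis) (auto simp: box_R_def abs_le_iff)
  then have "1 / (27 * sqrt n) \<le> R * M_mean n K"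
    using n by (intro M_mean_lower_bound[OF cK sK vK r n norm_R_basis R(1)]) auto
  moreover have "0 < 1 / (27 * sqrt n)" using n by simp
  ultimately have "0 < R * M_mean n K" by linarith
  then show ?thesis using R by (simp add: zero_less_mult_iff)
qed

lemma powr_three_halves:
  assumes "1 \<le> n"
  shows "real n powr (3/2) = n * sqrt n"
proof -
  have "real n powr (1 + 1/2) = real n powr 1 * real n powr (1/2)" by (rule powr_add)
  then show ?thesis using assms by (simp add: powr_half_sqrt)
qed

text \<open>
  If a ball of radius \<open>r\<close> does not fit into \<open>K\<close>, then \<open>K\<close> lies in a half-space at distance \<open>r\<close> from the
  origin, and then \<open>M(K)\<close> is at least of order \<open>1/(r \<surd>n)\<close>. So a ball of radius of order
  \<open>1/(M(K) \<surd>n)\<close> does fit, and \<open>S(K) \<le> n \<bar>K\<bar>/r\<close>.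
\<close>

lemma surface_area_upper_bound:
  assumes n: "1 \<le> n" and K: "convex_body n K" "centered n K"
  shows "surface_area n K \<le> ereal (54 * real n powr (3/2) * vol_R n K * M_mean n K)"
proof -
  note cK = convex_body_compact[OF K(1)] and sK = convex_body_subset[OF K(1)]
  have vK: "convex_R K" using K(1) by (simp add: convex_body_def)
  have M: "0 < M_mean n K" by (rule centered_M_mean_pos[OF n K])
  obtain r0 where r0: "0 < r0" "scale_set r0 (cball_R n) \<subseteq> K" by (rule centered_contains_ball[OF n K])
  \<comment> \<open>A half-space at distance \<open>r\<close> forces \<open>r \<ge> 1 / (27 \<surd>n M(K))\<close>; half of that value is excluded.\<close>
  define r where "r = 1 / (54 * sqrt n * M_mean n K)"
  have r: "0 < r" using n M by (simp add: r_def)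
  have "scale_set r (cball_R n) \<subseteq> K"
  proof (rule ccontr)
    assume "\<not> scale_set r (cball_R n) \<subseteq> K"
    moreover have "K \<noteq> {}" using r0(2) zero_in_cball_R by (auto simp: scale_set_def)
    ultimately obtain u where "norm_R n u = 1" "\<And>y. y \<in> K \<Longrightarrow> inner_R n y u \<le> r"
      using separating_direction[OF cK _ sK vK r] by metis
    then have "1 / (27 * sqrt n) \<le> r * M_mean n K"
      by (intro M_mean_lower_bound[OF cK sK vK r0 n _ r])
    also have "\<dots> = 1 / (54 * sqrt n)" using M by (simp add: r_def)
    finally show False using n by (simp add: field_simps)
  qed
  then have "surface_area n K \<le> ereal (n * vol_R n K / r)"
    by (rule surface_area_le[OF cK sK vK r])
  also have "n * vol_R n K / r = 54 * (n * sqrt n) * vol_R n K * M_mean n K"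
    by (simp add: r_def)
  also have "real n * sqrt n = real n powr (3/2)"
    by (rule powr_three_halves[OF n, symmetric])
  finally show ?thesis .
qed

section \<open>A double cone over a large cube\<close>

text \<open>
  For \<open>t = 0\<close> this is the double cone of height \<open>1\<close> over the cube \<open>[-n, n]\<^sup>n\<^sup>-\<^sup>1\<close> in the hyperplane \<open>x\<^sub>0 = 0\<close>.
  For \<open>t > 0\<close> each half is moved outwards by \<open>t\<close> along the axis and the gap is filled with a prism
  over the cube. The condition on \<open>x\<^sub>0\<close> alone is there for \<open>n = 1\<close>, where no coordinate \<open>i \<ge> 1\<close> exists.
\<close>

definition double_cone :: "nat \<Rightarrow> real \<Rightarrow> (nat \<Rightarrow> real) set" where
  "double_cone n t = {x \<in> topspace (Euclidean_space n). \<bar>x 0\<bar> \<le> 1 + t \<and>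
     (\<forall>i\<in>{1..<n}. \<bar>x i\<bar> \<le> n \<and> \<bar>x 0\<bar> + \<bar>x i\<bar> / n \<le> 1 + t)}"

lemma double_cone_subset: "double_cone n t \<subseteq> topspace (Euclidean_space n)"
  by (auto simp: double_cone_def)

lemma compact_double_cone: "compact (double_cone n t)"
proof (rule compact_Euclidean_closed_subset)
  have "double_cone n t = topspace (Euclidean_space n) \<inter> {x. \<bar>x 0\<bar> \<le> 1 + t} \<inter>
      (\<Inter>i\<in>{1..<n}. {x. \<bar>x i\<bar> \<le> n} \<inter> {x. \<bar>x 0\<bar> + \<bar>x i\<bar> / n \<le> 1 + t})"
    by (auto simp: double_cone_def)
  then show "closed (double_cone n t)"
    by (simp only:) (intro closed_Int closed_INT ballI closed_Euclidean_R closed_Collect_le continuous_intros; simp)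
  have "\<bar>x i\<bar> \<le> \<bar>1 + t\<bar> + n" if "x \<in> double_cone n t" "i < n" for x i
  proof (cases "i = 0")
    case True
    then have "\<bar>x i\<bar> \<le> 1 + t" using that(1) by (simp add: double_cone_def)
    then show ?thesis by linarith
  next
    case False
    then have "\<bar>x i\<bar> \<le> n" using that by (auto simp: double_cone_def)
    then show ?thesis by linarith
  qed
  then show "double_cone n t \<subseteq> box_R n (\<lambda>i. 0) (\<bar>1 + t\<bar> + n)"
    using subsetD[OF double_cone_subset] by (auto simp: box_R_def)
qed

text \<open>
  The volume of the stretched double cone as a function of the dimension \<open>m\<close> of its base, up to the
  volume of the base: a prism of height \<open>2 t\<close> and two cones of height \<open>1\<close>.
\<close>

lemma nn_integral_profile:
  fixes t :: real
  assumes t: "0 \<le> t"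
  shows "(\<integral>\<^sup>+ s. indicator {-(1+t)..1+t} s * ennreal ((min 1 (1 + t - \<bar>s\<bar>)) ^ m) \<partial>lborel) =
    ennreal (2 * t + 2 / Suc m)"
proof -
  let ?f1 = "\<lambda>s. ennreal ((1 + t + s) ^ m) * indicator {-1 - t..-t} s"
  let ?f2 = "\<lambda>s. indicator {-t..t} s :: ennreal"
  let ?f3 = "\<lambda>s. ennreal ((1 + t - s) ^ m) * indicator {t..1+t} s"
  have 1: "(\<integral>\<^sup>+ s. ?f1 s \<partial>lborel) = ennreal (1 / Suc m)"
  proof -
    have "(\<integral>\<^sup>+ s. ?f1 s \<partial>lborel) =
        (1 + t + (- t)) ^ Suc m / Suc m - (1 + t + (-1 - t)) ^ Suc m / Suc m"
    proof (rule nn_integral_FTC_Icc)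
      show "((\<lambda>s. (1 + t + s) ^ Suc m / Suc m) has_real_derivative (1 + t + s) ^ m) (at s)" for s
        by (rule derivative_eq_intros refl)+ (simp_all del: power_Suc of_nat_Suc)
    qed auto
    also have "\<dots> = ennreal (1 / Suc m)" by (simp del: of_nat_Suc)
    finally show ?thesis .
  qed
  have 3: "(\<integral>\<^sup>+ s. ?f3 s \<partial>lborel) = ennreal (1 / Suc m)"
  proof -
    have "(\<integral>\<^sup>+ s. ?f3 s \<partial>lborel) =
        - ((1 + t - (1 + t)) ^ Suc m) / Suc m - (- ((1 + t - t) ^ Suc m) / Suc m)"
    proof (rule nn_integral_FTC_Icc)
      show "((\<lambda>s. - ((1 + t - s) ^ Suc m) / Suc m) has_real_derivative (1 + t - s) ^ m) (at s)" for s
        by (rule derivative_eq_intros refl)+ (simp_all del: power_Suc of_nat_Suc)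
    qed (use t in auto)
    also have "\<dots> = ennreal (1 / Suc m)" by (simp del: of_nat_Suc)
    finally show ?thesis .
  qed
  \<comment> \<open>The three closed intervals overlap only in the points \<open>t\<close> and \<open>-t\<close>.\<close>
  have "AE s in lborel. indicator {-(1+t)..1+t} s * ennreal ((min 1 (1 + t - \<bar>s\<bar>)) ^ m) =
      ?f1 s + ?f2 s + ?f3 s"
    using AE_lborel_singleton[of t] AE_lborel_singleton[of "-t"]
  proof eventually_elim
    case (elim s)
    consider "s < - t" | "-t < s" "s < t" | "t < s" using elim t by linarith
    then show ?case using t by cases (auto simp: indicator_def min_def)
  qed
  then have "(\<integral>\<^sup>+ s. indicator {-(1+t)..1+t} s * ennreal ((min 1 (1 + t - \<bar>s\<bar>)) ^ m) \<partial>lborel) =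
      (\<integral>\<^sup>+ s. ?f1 s + ?f2 s + ?f3 s \<partial>lborel)"
    by (rule nn_integral_cong_AE)
  also have "\<dots> = ennreal (1 / Suc m) + ennreal (t - (- t)) + ennreal (1 / Suc m)"
    using t by (simp add: nn_integral_add 1 3 del: of_nat_Suc)
  also have "\<dots> = ennreal (2 * t + 2 / Suc m)"
    using t by (simp add: ennreal_plus[symmetric] del: ennreal_plus of_nat_Suc)
  finally show ?thesis .
qed

text \<open>
  The slice at height \<open>x\<^sub>0 = s\<close> is a cube of half-width \<open>n min(1, 1 + t - \<bar>s\<bar>)\<close>.
\<close>

lemma vol_double_cone:
  assumes n: "1 \<le> n" and t: "0 \<le> t"
  shows "vol_R n (double_cone n t) = (2 * real n) ^ (n - 1) * (2 * t + 2 / n)"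
proof -
  interpret product_sigma_finite "\<lambda>_::nat. lborel :: real measure" ..
  let ?I = "{1..<n}"
  let ?C = "double_cone n t"
  let ?P = "\<Pi>\<^sub>M i\<in>{..<n}. (lborel :: real measure)" and ?Q = "\<Pi>\<^sub>M i\<in>?I. (lborel :: real measure)"
  define a where "a s = n * min 1 (1 + t - \<bar>s\<bar>)" for s
  have ins: "insert 0 ?I = {..<n}" using n by auto
  have C[measurable]: "?C \<in> sets borel" by (simp add: borel_compact compact_double_cone)
  have [measurable]: "embed_R n \<in> ?P \<rightarrow>\<^sub>M borel" by (rule measurable_embed_R)
  have m: "(\<lambda>x. indicator ?C (embed_R n x) :: ennreal) \<in> borel_measurable (Pi\<^sub>M (insert 0 ?I) (\<lambda>_. lborel))"
    unfolding ins by measurable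
  have slice: "(\<integral>\<^sup>+ y. indicator ?C (embed_R n (y(0 := s))) \<partial>?Q) =
     indicator {-(1+t)..1+t} s * ennreal ((2 * real n) ^ (n - 1) * (min 1 (1 + t - \<bar>s\<bar>)) ^ (n - 1))" for s
  proof -
    have iff: "embed_R n (y(0 := s)) \<in> ?C \<longleftrightarrow> s \<in> {-(1+t)..1+t} \<and> y \<in> Pi\<^sub>E ?I (\<lambda>_. {- a s..a s})"
      if "y \<in> space ?Q" for y
    proof -
      have ea: "\<bar>c\<bar> \<le> n \<and> \<bar>s\<bar> + \<bar>c\<bar> / n \<le> 1 + t \<longleftrightarrow> c \<in> {- a s..a s}" for c :: real
      proof -
        have "\<bar>s\<bar> + \<bar>c\<bar> / n \<le> 1 + t \<longleftrightarrow> \<bar>c\<bar> \<le> n * (1 + t - \<bar>s\<bar>)"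
          using n by (simp add: field_simps)
        moreover have "a s = min n (n * (1 + t - \<bar>s\<bar>))"
          using n by (auto simp: a_def min_def)
        ultimately show ?thesis by (auto simp: abs_le_iff)
      qed
      have "y \<in> Pi\<^sub>E ?I (\<lambda>_. {- a s..a s}) \<longleftrightarrow> (\<forall>i\<in>?I. y i \<in> {- a s..a s})"
        using that by (auto simp: space_PiM PiE_def Pi_def)
      moreover have "embed_R n (y(0 := s)) \<in> ?C \<longleftrightarrow>
          \<bar>s\<bar> \<le> 1 + t \<and> (\<forall>i\<in>?I. \<bar>y i\<bar> \<le> n \<and> \<bar>s\<bar> + \<bar>y i\<bar> / n \<le> 1 + t)"
        using n by (simp add: double_cone_def embed_R_def topspace_Euclidean_space)
      moreover have "\<bar>s\<bar> \<le> 1 + t \<longleftrightarrow> s \<in> {-(1+t)..1+t}" by auto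
      ultimately show ?thesis by (simp only: ea)
    qed
    have "(\<integral>\<^sup>+ y. indicator ?C (embed_R n (y(0 := s))) \<partial>?Q) =
        (\<integral>\<^sup>+ y. indicator {-(1+t)..1+t} s * indicator (Pi\<^sub>E ?I (\<lambda>_. {- a s..a s})) y \<partial>?Q)"
      by (intro nn_integral_cong) (simp add: indicator_def iff)
    also have "\<dots> = indicator {-(1+t)..1+t} s * emeasure ?Q (Pi\<^sub>E ?I (\<lambda>_. {- a s..a s}))"
      by (intro nn_integral_cmult_indicator sets_PiM_I_finite) auto
    also have "\<dots> = indicator {-(1+t)..1+t} s * ennreal ((2 * real n) ^ (n - 1) * (min 1 (1 + t - \<bar>s\<bar>)) ^ (n - 1))"
    proof (cases "s \<in> {-(1+t)..1+t}")
      case True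
      then have "0 \<le> a s" using n by (auto simp: a_def)
      then have "emeasure ?Q (Pi\<^sub>E ?I (\<lambda>_. {- a s..a s})) = ennreal ((2 * a s) ^ (n - 1))"
        by (simp add: emeasure_PiM ennreal_power)
      also have "(2 * a s) ^ (n - 1) = (2 * real n) ^ (n - 1) * (min 1 (1 + t - \<bar>s\<bar>)) ^ (n - 1)"
        by (simp only: a_def mult.assoc[symmetric] power_mult_distrib)
      finally show ?thesis by simp
    qed simp
    finally show ?thesis .
  qed
  have "emeasure (lborel_R n) ?C = (\<integral>\<^sup>+ x. indicator ?C x \<partial>lborel_R n)"
    by (rule nn_integral_indicator[symmetric]) simp
  also have "\<dots> = (\<integral>\<^sup>+ x. indicator ?C (embed_R n x) \<partial>Pi\<^sub>M (insert 0 ?I) (\<lambda>_. lborel))"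
    unfolding lborel_R_def ins by (rule nn_integral_distr) measurable
  also have "\<dots> = (\<integral>\<^sup>+ s. \<integral>\<^sup>+ y. indicator ?C (embed_R n (y(0 := s))) \<partial>?Q \<partial>lborel)"
    by (rule product_nn_integral_insert_rev[OF _ _ m]) auto
  also have "\<dots> = (\<integral>\<^sup>+ s. ennreal ((2 * real n) ^ (n - 1)) * (indicator {-(1+t)..1+t} s * ennreal ((min 1 (1 + t - \<bar>s\<bar>)) ^ (n - 1))) \<partial>lborel)"
    unfolding slice by (intro nn_integral_cong) (auto simp: indicator_def ennreal_mult')
  also have "\<dots> = ennreal ((2 * real n) ^ (n - 1)) * ennreal (2 * t + 2 / Suc (n - 1))"
  proof (subst nn_integral_cmult)
    have "(\<lambda>s. (min 1 (1 + t - \<bar>s\<bar>)) ^ (n - 1)) \<in> borel_measurable borel"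
      by (intro borel_measurable_continuous_onI continuous_intros)
    then show "(\<lambda>s. indicator {-(1+t)..1+t} s * ennreal ((min 1 (1 + t - \<bar>s\<bar>)) ^ (n - 1)))
        \<in> borel_measurable lborel"
      by simp
  qed (simp only: nn_integral_profile[OF t])
  also have "\<dots> = ennreal ((2 * real n) ^ (n - 1) * (2 * t + 2 / n))"
    using n t by (simp add: ennreal_mult)
  finally show ?thesis
    using t by (simp add: vol_R_def measure_def)
qed

lemma convex_body_double_cone:
  assumes n: "1 \<le> n"
  shows "convex_body n (double_cone n 0)"
  unfolding convex_body_def
proof (intro conjI)
  show "compactin (Euclidean_space n) (double_cone n 0)"
    unfolding Euclidean_space_def compactin_subtopology euclidean_product_topology
    using compact_double_cone double_cone_subset[of n 0] by (simp add: topspace_Euclidean_space)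
  show "convex_R (double_cone n 0)"
    unfolding convex_R_def
  proof (intro ballI allI impI)
    fix x y :: "nat \<Rightarrow> real" and u v :: real
    assume x: "x \<in> double_cone n 0" and y: "y \<in> double_cone n 0" and uv: "0 \<le> u" "0 \<le> v" "u + v = 1"
    have comb: "\<bar>u * p + v * q\<bar> \<le> u * \<bar>p\<bar> + v * \<bar>q\<bar>" for p q :: real
      using uv by (metis abs_mult abs_of_nonneg abs_triangle_ineq)
    have le: "u * p + v * q \<le> c" if "p \<le> c" "q \<le> c" for p q c :: real
    proof -
      have "u * p + v * q \<le> u * c + v * c" using that uv by (intro add_mono mult_left_mono) auto
      then show ?thesis using uv by (simp add: distrib_right[symmetric])
    qed
    have "\<bar>u * x 0 + v * y 0\<bar> + \<bar>u * x i + v * y i\<bar> / n \<le> 1" if i: "i \<in> {1..<n}" for i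
    proof -
      have "\<bar>u * x 0 + v * y 0\<bar> + \<bar>u * x i + v * y i\<bar> / n \<le>
          (u * \<bar>x 0\<bar> + v * \<bar>y 0\<bar>) + (u * \<bar>x i\<bar> + v * \<bar>y i\<bar>) / n"
        by (intro add_mono divide_right_mono comb) auto
      also have "\<dots> = u * (\<bar>x 0\<bar> + \<bar>x i\<bar> / n) + v * (\<bar>y 0\<bar> + \<bar>y i\<bar> / n)"
        by (simp add: algebra_simps add_divide_distrib)
      also have "\<dots> \<le> 1" using x y i by (intro le) (auto simp: double_cone_def)
      finally show ?thesis .
    qed
    moreover have "\<bar>u * x i + v * y i\<bar> \<le> n" if i: "i \<in> {1..<n}" for i
      using order_trans[OF comb le] x y i by (auto simp: double_cone_def)
    moreover have "\<bar>u * x 0 + v * y 0\<bar> \<le> 1"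
      using order_trans[OF comb le] x y by (auto simp: double_cone_def)
    ultimately show "(\<lambda>i. u * x i + v * y i) \<in> double_cone n 0"
      using x y by (auto simp: double_cone_def topspace_Euclidean_space)
  qed
  let ?U = "\<Inter>i\<in>{..<n}. {x :: nat \<Rightarrow> real. \<bar>x i\<bar> < 1 / 2}"
  have "open ?U"
    by (intro open_INT ballI open_Collect_less continuous_intros) auto
  then have "openin euclidean ?U" by (rule iffD1[OF open_openin])
  then have "openin (Euclidean_space n) (?U \<inter> topspace (Euclidean_space n))"
    unfolding topspace_Euclidean_space unfolding Euclidean_space_def euclidean_product_topology
    by (rule openin_subtopology_Int)
  moreover have "?U \<inter> topspace (Euclidean_space n) \<subseteq> double_cone n 0"
  proof
    fix x assume x: "x \<in> ?U \<inter> topspace (Euclidean_space n)"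
    then have h: "\<bar>x i\<bar> < 1 / 2" if "i < n" for i using that by auto
    have "\<bar>x i\<bar> \<le> n \<and> \<bar>x 0\<bar> + \<bar>x i\<bar> / n \<le> 1" if "i \<in> {1..<n}" for i
    proof -
      have i: "\<bar>x i\<bar> < 1 / 2" "\<bar>x 0\<bar> < 1 / 2" using h that n by auto
      then have "\<bar>x i\<bar> / n \<le> 1 / 2 / 1" using n by (intro frac_le) auto
      then show ?thesis using i n by linarith
    qed
    moreover have "\<bar>x 0\<bar> \<le> 1" using h[of 0] n by simp
    ultimately show "x \<in> double_cone n 0" using x by (simp add: double_cone_def)
  qed
  ultimately have "?U \<inter> topspace (Euclidean_space n) \<subseteq> Euclidean_space n interior_of double_cone n 0"
    by (intro interior_of_maximal)
  moreover have "(\<lambda>i. 0) \<in> ?U \<inter> topspace (Euclidean_space n)"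
    by (simp add: topspace_Euclidean_space)
  ultimately show "Euclidean_space n interior_of double_cone n 0 \<noteq> {}" by blast
qed

lemma centered_double_cone: "centered n (double_cone n 0)"
proof -
  have "(LINT x|lborel_R n. indicator (double_cone n 0) x * x i) = 0" for i
  proof -
    let ?f = "\<lambda>x::nat \<Rightarrow> real. indicator (double_cone n 0) x * x i"
    have [measurable]: "double_cone n 0 \<in> sets borel" by (simp add: borel_compact compact_double_cone)
    have "(\<lambda>j. - x j) \<in> double_cone n 0 \<longleftrightarrow> x \<in> double_cone n 0" for x
      by (simp add: double_cone_def topspace_Euclidean_space)
    then have odd: "?f (\<lambda>j. - x j) = - ?f x" for x by (simp add: indicator_def)
    have "(LINT x|lborel_R n. ?f x) = (LINT x|lborel_R n. ?f (\<lambda>j. - x j))"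
      by (rule integral_lborel_R_uminus[symmetric]) measurable
    also have "\<dots> = - (LINT x|lborel_R n. ?f x)"
      unfolding odd by simp
    finally show ?thesis by simp
  qed
  then show ?thesis
    by (simp add: centered_def barycenter_def set_lebesgue_integral_def)
qed

text \<open>
  Moving a point back along the axis by at most \<open>t\<close> leads from the stretched double cone to the
  double cone itself.
\<close>

lemma double_cone_subset_minkowski_sum:
  assumes n: "1 \<le> n" and t: "0 < t"
  shows "double_cone n t \<subseteq> minkowski_sum (double_cone n 0) (scale_set t (cball_R n))"
proof
  fix x assume x: "x \<in> double_cone n t"
  define c where "c = max (- t) (min t (x 0))"
  define y where "y = (\<lambda>i. if i = 0 then x 0 - c else x i)"
  define b where "b = (\<lambda>i::nat. c / t * (if i = 0 then 1 else 0))"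
  have c: "\<bar>c\<bar> \<le> t" "\<bar>x 0 - c\<bar> = max 0 (\<bar>x 0\<bar> - t)" using t by (auto simp: c_def)
  have "b \<in> cball_R n"
    using n t c(1) unfolding cball_R_eq mem_Collect_eq b_def norm_R_scale
    by (auto simp: norm_R_basis)
  then have "(\<lambda>i. t * b i) \<in> scale_set t (cball_R n)" unfolding scale_set_def by (rule imageI)
  moreover have "y \<in> double_cone n 0"
  proof -
    have "\<bar>x i\<bar> / n \<le> 1" if "i \<in> {1..<n}" for i
      using x that n by (auto simp: double_cone_def)
    then show ?thesis
      using x n c(2) by (auto simp: double_cone_def y_def topspace_Euclidean_space max_def)
  qed
  moreover have "x = (\<lambda>i. y i + t * b i)" using t by (auto simp: y_def b_def)
  ultimately show "x \<in> minkowski_sum (double_cone n 0) (scale_set t (cball_R n))"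
    unfolding minkowski_sum_def mem_Collect_eq
    by (intro exI[of _ y] exI[of _ "\<lambda>i. t * b i"] conjI)
qed

lemma minkowski_sum_subset:
  "A \<subseteq> topspace (Euclidean_space n) \<Longrightarrow> B \<subseteq> topspace (Euclidean_space n) \<Longrightarrow>
    minkowski_sum A B \<subseteq> topspace (Euclidean_space n)"
  by (auto simp: minkowski_sum_def topspace_Euclidean_space subset_iff)

text \<open>
  Stretching along the axis alone already adds \<open>2 t\<close> times the volume of the base to the volume, and
  the double cone has volume \<open>2/n\<close> times that of its base.
\<close>

lemma surface_area_double_cone:
  assumes n: "1 \<le> n"
  shows "ereal (n * vol_R n (double_cone n 0)) \<le> surface_area n (double_cone n 0)"
  unfolding surface_area_def
proof (rule Liminf_bounded, rule eventually_at_rightI[of 0 1])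
  fix t :: real assume "t \<in> {0<..<1}"
  then have t: "0 < t" by simp
  let ?S = "minkowski_sum (double_cone n 0) (scale_set t (cball_R n))"
  have "vol_R n (double_cone n t) \<le> vol_R n ?S"
    unfolding vol_R_def
    by (intro measure_mono_fmeasurable double_cone_subset_minkowski_sum n t fmeasurable_compact_R
        compact_minkowski_sum compact_scale_set compact_cball_R compact_double_cone
        minkowski_sum_subset scale_set_subset cball_R_subset double_cone_subset)
      (simp add: borel_compact compact_double_cone)
  moreover have "vol_R n (double_cone n t) = vol_R n (double_cone n 0) + t * (n * vol_R n (double_cone n 0))"
    using n t by (simp add: vol_double_cone algebra_simps)
  ultimately show "ereal (n * vol_R n (double_cone n 0)) \<le> ereal ((vol_R n ?S - vol_R n (double_cone n 0)) / t)"
    using t by (simp add: field_simps)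
qed simp

text \<open>
  Coefficients of a weighted \<open>\<ell>\<^sub>1\<close> norm that bounds the Minkowski functional of the double cone. The
  axis has weight \<open>1\<close>, and the width \<open>n\<close> of the base makes all other directions together count at most
  as much as the axis.
\<close>

definition cone_weight :: "nat \<Rightarrow> nat \<Rightarrow> real" where
  "cone_weight n i = (if i = 0 then 1 else 1 / n)"

lemma sum_cone_weight: "1 \<le> n \<Longrightarrow> (\<Sum>i<n. cone_weight n i) \<le> 2"
proof -
  assume n: "1 \<le> n"
  have "{..<n} = insert 0 {1..<n}" using n by auto
  then have "(\<Sum>i<n. cone_weight n i) = 1 + (\<Sum>i=1..<n. cone_weight n i)"
    by (simp add: cone_weight_def)
  also have "(\<Sum>i=1..<n. cone_weight n i) = (\<Sum>i=1..<n. 1 / n)"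
    by (intro sum.cong) (auto simp: cone_weight_def)
  also have "1 + \<dots> \<le> 2" using n by (simp add: field_simps)
  finally show ?thesis .
qed

lemma minkowski_functional_double_cone_le:
  assumes n: "1 \<le> n" and x: "x \<in> topspace (Euclidean_space n)"
  shows "minkowski_functional (double_cone n 0) x \<le> (\<Sum>i<n. cone_weight n i * \<bar>x i\<bar>)"
proof -
  define T where "T = (\<Sum>i<n. cone_weight n i * \<bar>x i\<bar>)"
  have w: "0 < cone_weight n i" for i using n by (simp add: cone_weight_def)
  have T: "0 \<le> T" unfolding T_def using w by (intro sum_nonneg mult_nonneg_nonneg) (auto simp: less_imp_le[OF w])
  have "x \<in> scale_set T (double_cone n 0)"
  proof (cases "T = 0")
    case True
    then have "cone_weight n i * \<bar>x i\<bar> = 0" if "i < n" for i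
      using that w unfolding T_def
      by (subst (asm) sum_nonneg_eq_0_iff) (auto simp: less_imp_le[OF w])
    then have "x i = 0" for i
      using less_imp_neq[OF w[of i]] x by (cases "i < n") (auto simp: topspace_Euclidean_space)
    then have "x = (\<lambda>i. 0 * 0)" by auto
    moreover have "(\<lambda>i. 0 * (0::real)) \<in> scale_set 0 (double_cone n 0)"
      unfolding scale_set_def by (rule imageI) (simp add: double_cone_def topspace_Euclidean_space)
    ultimately show ?thesis using True by simp
  next
    case False
    then have pos: "0 < T" using T by simp
    have 0: "\<bar>x 0\<bar> \<le> T"
    proof -
      have "(\<Sum>i\<in>{0}. cone_weight n i * \<bar>x i\<bar>) \<le> T"
        unfolding T_def using n w by (intro sum_mono2) (auto simp: less_imp_le[OF w])
      then show ?thesis by (simp add: cone_weight_def)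
    qed
    have 1: "\<bar>x 0\<bar> + \<bar>x i\<bar> / n \<le> T" if "i \<in> {1..<n}" for i
    proof -
      have "(\<Sum>i\<in>{0, i}. cone_weight n i * \<bar>x i\<bar>) \<le> T"
        unfolding T_def using that w by (intro sum_mono2) (auto simp: less_imp_le[OF w])
      then show ?thesis using that by (simp add: cone_weight_def)
    qed
    have "(\<lambda>i. x i / T) \<in> double_cone n 0"
    proof -
      have "\<bar>x i / T\<bar> \<le> n \<and> \<bar>x 0 / T\<bar> + \<bar>x i / T\<bar> / n \<le> 1" if i: "i \<in> {1..<n}" for i
      proof -
        have "\<bar>x i\<bar> / n \<le> T" using 1[OF i] by simp
        then have "\<bar>x i / T\<bar> \<le> n" using pos n by (simp add: field_simps)
        moreover have "\<bar>x 0 / T\<bar> + \<bar>x i / T\<bar> / n = (\<bar>x 0\<bar> + \<bar>x i\<bar> / n) / T"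
          using pos by (simp add: add_divide_distrib)
        moreover have "\<dots> \<le> 1" using 1[OF i] pos by simp
        ultimately show ?thesis by simp
      qed
      then show ?thesis using 0 pos x by (simp add: double_cone_def topspace_Euclidean_space)
    qed
    then have "(\<lambda>i. T * (x i / T)) \<in> scale_set T (double_cone n 0)"
      unfolding scale_set_def by (rule imageI)
    then show ?thesis using pos by simp
  qed
  then show ?thesis
    unfolding minkowski_functional_def T_def[symmetric] using T
    by (intro cInf_lower) (auto intro!: bdd_belowI[of _ 0])
qed

text \<open>
  The second moment is at most \<open>1/n\<close>, and \<open>2 \<bar>c\<bar> \<le> \<surd>n c\<^sup>2 + 1/\<surd>n\<close> by the inequality between the
  arithmetic and the geometric mean.
\<close>

lemma ball_integral_abs_coordinate:
  assumes "i < n"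
  shows "ball_integral n (\<lambda>x. \<bar>x i\<bar>) \<le> vol_R n (cball_R n) / sqrt n"
proof -
  let ?V = "vol_R n (cball_R n)"
  have n: "0 < n" using assms by auto
  have V: "0 \<le> ?V" by (simp add: vol_R_def)
  have pt: "\<bar>c\<bar> \<le> 1 / 2 * (sqrt n * c\<^sup>2 + 1 / sqrt n * 1)" for c :: real
  proof -
    have "0 \<le> (sqrt n * \<bar>c\<bar> - 1)\<^sup>2" by simp
    also have "\<dots> = n * c\<^sup>2 + 1 - 2 * (sqrt n * \<bar>c\<bar>)"
      by (simp add: power2_diff power_mult_distrib)
    finally have "2 * (sqrt n * \<bar>c\<bar>) \<le> n * c\<^sup>2 + 1" by simp
    then have "2 * (sqrt n * \<bar>c\<bar>) / sqrt n \<le> (n * c\<^sup>2 + 1) / sqrt n"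
      by (rule divide_right_mono) simp
    also have "(n * c\<^sup>2 + 1) / sqrt n = sqrt n * c\<^sup>2 + 1 / sqrt n * 1"
      using n by (simp add: add_divide_distrib real_div_sqrt flip: times_divide_eq_left)
    finally show ?thesis using n by simp
  qed
  have "ball_integral n (\<lambda>x. \<bar>x i\<bar>) \<le> ball_integral n (\<lambda>x. 1 / 2 * (sqrt n * (x i)\<^sup>2 + 1 / sqrt n * 1))"
    unfolding ball_integral_def
    by (intro integral_mono integrable_on_cball_R continuous_intros mult_left_mono pt) auto
  also have "\<dots> = 1 / 2 * (sqrt n * (?V / (n + 2)) + 1 / sqrt n * ?V)"
    using ball_moment_2[OF norm_R_basis[OF assms]] assms
    by (subst ball_integral_cmult ball_integral_add ball_integral_cmult ball_integral_1; (intro continuous_intros)?)+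
      (simp add: inner_R_basis)
  also have "\<dots> \<le> 1 / 2 * (sqrt n * (?V / n) + 1 / sqrt n * ?V)"
    using V n by (intro mult_left_mono add_mono divide_left_mono) auto
  also have "sqrt n * (?V / n) = ?V / sqrt n"
    using n by (simp add: field_simps)
  finally show ?thesis by simp
qed

text \<open>
  A coordinate of a point on the sphere has mean absolute value of order \<open>1/\<surd>n\<close>. This is transferred
  from the ball by \<open>\<bar>x\<^sub>i\<bar>/\<bar>x\<bar> \<le> 2 \<bar>x\<^sub>i\<bar>\<close> outside the ball of radius \<open>1/2\<close>; inside it the quotient is at
  most \<open>1\<close>, and that smaller ball has only the fraction \<open>2\<^sup>-\<^sup>n \<le> 1/\<surd>n\<close> of the volume.
\<close>

lemma M_mean_double_cone:
  assumes n: "1 \<le> n"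
  shows "M_mean n (double_cone n 0) \<le> 6 / sqrt n"
proof -
  let ?K = "double_cone n 0" and ?V = "vol_R n (cball_R n)" and ?B = "cball_R n"
  let ?H = "scale_set (1 / 2) (cball_R n)"
  let ?w = "cone_weight n"
  have V: "0 < ?V" by (rule vol_cball_pos[OF n])
  have w: "0 \<le> ?w i" for i by (simp add: cone_weight_def)
  have K: "convex_R ?K" using convex_body_double_cone[OF n] by (simp add: convex_body_def)
  obtain r where r: "0 < r" "scale_set r (cball_R n) \<subseteq> ?K"
    by (rule centered_contains_ball[OF n convex_body_double_cone[OF n] centered_double_cone])
  note mink = compact_double_cone double_cone_subset K r
  have H: "x \<in> ?H \<longleftrightarrow> x \<in> topspace (Euclidean_space n) \<and> norm_R n x \<le> 1 / 2" for x
  proof -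
    have "x \<in> ?H \<longleftrightarrow> (\<lambda>i. 2 * x i) \<in> ?B" by (simp add: scale_set_eq_vimage)
    then show ?thesis
      unfolding cball_R_def mem_Collect_eq norm_R_scale by (auto simp: topspace_Euclidean_space)
  qed
  have Hc: "compact ?H" "?H \<subseteq> topspace (Euclidean_space n)"
    by (auto simp: compact_scale_set compact_cball_R H)
  have volH: "vol_R n ?H \<le> ?V / sqrt n"
  proof -
    have "sqrt n \<le> n" using n by (intro real_le_lsqrt) (auto simp: power2_eq_square)
    also have "real n < 2 ^ n" by (rule of_nat_less_two_power)
    finally have "(1 / 2) ^ n \<le> 1 / sqrt n" using n by (simp add: power_divide field_simps)
    then have "(1 / 2) ^ n * ?V \<le> 1 / sqrt n * ?V" using V by (intro mult_right_mono) auto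
    then show ?thesis by (subst vol_scale_set) (auto simp: )
  qed
  define e where "e i x = 2 * (indicator ?B x * \<bar>x i\<bar>) + indicator ?H x" for i :: nat and x :: "nat \<Rightarrow> real"
  have intH: "integrable (lborel_R n) (\<lambda>x. indicator ?H x :: real)"
    using integrable_continuous_on_compact_R[OF Hc, of "\<lambda>x. 1"] by simp
  have intB: "integrable (lborel_R n) (\<lambda>x. indicator ?B x * \<bar>x i\<bar>)" for i
    by (intro integrable_on_cball_R continuous_intros)
  have inte: "integrable (lborel_R n) (e i)" for i
    unfolding e_def using intH intB by auto
  have e_le: "(LINT x|lborel_R n. e i x) \<le> 3 * ?V / sqrt n" if "i < n" for i
  proof -
    have "(LINT x|lborel_R n. e i x) = 2 * ball_integral n (\<lambda>x. \<bar>x i\<bar>) + vol_R n ?H"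
      unfolding e_def ball_integral_def using intH intB by (simp add: vol_R_def)
    then show ?thesis using ball_integral_abs_coordinate[OF that] volH by simp
  qed
  have pt: "indicator ?B x * minkowski_functional ?K (normalize_R n x) \<le> (\<Sum>i<n. ?w i * e i x)" for x
  proof (cases "x \<in> ?B")
    case False
    then show ?thesis using w by (auto intro!: sum_nonneg simp: e_def)
  next
    case True
    then have x: "x \<in> topspace (Euclidean_space n)" using cball_R_subset by blast
    have "minkowski_functional ?K (normalize_R n x) \<le> (\<Sum>i<n. ?w i * \<bar>normalize_R n x i\<bar>)"
      by (rule minkowski_functional_double_cone_le[OF n normalize_R_in[OF x]])
    also have "\<dots> \<le> (\<Sum>i<n. ?w i * e i x)"
    proof (intro sum_mono mult_left_mono w)
      fix i assume "i \<in> {..<n}"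
      then have i: "\<bar>x i\<bar> \<le> norm_R n x" by (simp add: abs_coordinate_le_norm_R)
      show "\<bar>normalize_R n x i\<bar> \<le> e i x"
      proof (cases "x \<in> ?H")
        case H: True
        have "\<bar>normalize_R n x i\<bar> \<le> 1"
          using i norm_R_nonneg[of n x] by (simp add: normalize_R_def divide_le_eq_1) linarith
        then show ?thesis using H True by (simp add: e_def)
      next
        case False
        then have "1 / 2 < norm_R n x" using x by (simp add: H)
        then have "\<bar>x i\<bar> / norm_R n x \<le> \<bar>x i\<bar> / (1 / 2)"
          by (intro divide_left_mono) auto
        then show ?thesis using True False by (simp add: e_def normalize_R_def)
      qed
    qed
    finally show ?thesis using True by simp
  qed
  have "ball_integral n (\<lambda>x. minkowski_functional ?K (normalize_R n x)) \<le>
      (LINT x|lborel_R n. (\<Sum>i<n. ?w i * e i x))"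
    unfolding ball_integral_def
    by (intro integral_mono integrable_minkowski_functional_normalize[OF mink] pt
        Bochner_Integration.integrable_sum integrable_mult_right inte)
  also have "\<dots> = (\<Sum>i<n. ?w i * (LINT x|lborel_R n. e i x))"
    using inte by simp
  also have "\<dots> \<le> (\<Sum>i<n. ?w i * (3 * ?V / sqrt n))"
    by (intro sum_mono mult_left_mono w e_le) simp
  also have "\<dots> \<le> 2 * (3 * ?V / sqrt n)"
    unfolding sum_distrib_right[symmetric] using V
    by (intro mult_right_mono sum_cone_weight n) auto
  finally show ?thesis
    using V n unfolding M_mean_eq_ball_integral[OF n measurable_minkowski_functional[OF mink]]
    by (simp add: field_simps)
qed

lemma p_ratio_double_cone:
  assumes n: "1 \<le> n"
  shows "ereal (1 / 6 * real n powr (3/2)) \<le> p_ratio n (double_cone n 0)"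
proof -
  let ?K = "double_cone n 0"
  have v: "0 < vol_R n ?K" by (rule convex_body_vol_pos[OF convex_body_double_cone[OF n]])
  have M: "0 < M_mean n ?K"
    by (rule centered_M_mean_pos[OF n convex_body_double_cone[OF n] centered_double_cone])
  have "real n powr (3/2) = n * sqrt n" by (rule powr_three_halves[OF n])
  moreover have "1 / 6 * (n * sqrt n) \<le> n / M_mean n ?K"
  proof -
    have "n / (6 / sqrt n) \<le> n / M_mean n ?K"
      using M M_mean_double_cone[OF n] n by (intro divide_left_mono) auto
    then show ?thesis by simp
  qed
  ultimately have "ereal (1 / 6 * real n powr (3/2)) \<le> ereal (n * vol_R n ?K) / ereal (vol_R n ?K * M_mean n ?K)"
    using v by simp
  also have "\<dots> \<le> p_ratio n ?K"
    unfolding p_ratio_def using v M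
    by (intro ereal_divide_right_mono surface_area_double_cone n) simp
  finally show ?thesis .
qed

section \<open>The order of the extremal ratio\<close>

theorem theorem6p1:
  shows "(\<exists>c>0. \<forall>n\<ge>1. \<forall>K. convex_body n K \<and> centered n K \<longrightarrow>
            surface_area n K \<le> ereal (c * real n powr (3/2) * vol_R n K * M_mean n K))
       \<and> (\<exists>c\<^sub>1>0. \<exists>c\<^sub>2>0. \<forall>n\<ge>1.
            ereal (c\<^sub>1 * real n powr (3/2))
              \<le> (SUP K \<in> {K. convex_body n K \<and> centered n K}. p_ratio n K)
          \<and> (SUP K \<in> {K. convex_body n K \<and> centered n K}. p_ratio n K)
              \<le> ereal (c\<^sub>2 * real n powr (3/2)))"
proof (rule conjI)
  show "\<exists>c>0. \<forall>n\<ge>1. \<forall>K. convex_body n K \<and> centered n K \<longrightarrow>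
      surface_area n K \<le> ereal (c * real n powr (3/2) * vol_R n K * M_mean n K)"
    using surface_area_upper_bound by (intro exI[of _ 54]) auto
  have upper: "p_ratio n K \<le> ereal (54 * real n powr (3/2))"
    if n: "1 \<le> n" and K: "convex_body n K" "centered n K" for n K
  proof -
    have pos: "0 < vol_R n K" "0 < M_mean n K"
      using convex_body_vol_pos[OF K(1)] centered_M_mean_pos[OF n K] .
    have "p_ratio n K \<le> ereal (54 * real n powr (3/2) * vol_R n K * M_mean n K) / ereal (vol_R n K * M_mean n K)"
      unfolding p_ratio_def using pos
      by (intro ereal_divide_right_mono surface_area_upper_bound n K) simp
    also have "\<dots> = ereal (54 * real n powr (3/2))"
      using pos by (simp add: mult.assoc)
    finally show ?thesis .
  qed
  show "\<exists>c\<^sub>1>0. \<exists>c\<^sub>2>0. \<forall>n\<ge>1.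
            ereal (c\<^sub>1 * real n powr (3/2))
              \<le> (SUP K \<in> {K. convex_body n K \<and> centered n K}. p_ratio n K)
          \<and> (SUP K \<in> {K. convex_body n K \<and> centered n K}. p_ratio n K)
              \<le> ereal (c\<^sub>2 * real n powr (3/2))"
  proof (rule exI[where x = "1 / 6"], rule conjI[rotated], rule exI[where x = 54], intro conjI allI impI)
    fix n :: nat assume n: "1 \<le> n"
    show "ereal (1 / 6 * real n powr (3/2)) \<le> (SUP K \<in> {K. convex_body n K \<and> centered n K}. p_ratio n K)"
      using convex_body_double_cone[OF n] centered_double_cone
        p_ratio_double_cone[OF n]
      by (intro SUP_upper2[where i = "double_cone n 0"]) simp_all
    show "(SUP K \<in> {K. convex_body n K \<and> centered n K}. p_ratio n K) \<le> ereal (54 * real n powr (3/2))"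
      using upper[OF n] by (intro SUP_least) auto
  qed auto
qed

end
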